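(* Let $k$ be an algebraically closed field of characteristic $0$, let $n,m\ge 1$ and let $E=(e_{ij})\in M_{n,m}(\mathbb{Z})$ be a matrix with elementary divisors $d_1\mid d_2\mid\dots\mid d_r$ (the positive diagonal entries of its Smith normal form, $r=\operatorname{rank}E$). Let $\mathcal{F}_E$ be the functor of orbits of the torus action with exponent matrix $E$, and let $[x]\in\mathcal{F}_E(k(x_1,\dots,x_n))$ be its generic point. If $l$ is the number of ones among $d_1,\dots,d_r$, then $$\operatorname{ed}[x]=n-l .$$
   Context: For a field extension $K/k$, the torus $(K^* )^m$ acts on $K^n$ by $(\lambda\cdot a)_i=a_i\,\lambda_1^{e_{i1}}\cdots\lambda_m^{e_{im}}$, $i=1,\dots,n$. Define $\mathcal{F}_E(K)=K^n/\!\sim$ as the set of $(K^* )^m$-orbits in $K^n$; for an inclusion $K_0\subset K$ of extensions of $k$ the map $\mathcal{F}_E(K_0)\to\mathcal{F}_E(K)$ is induced by $K_0^n\subset K^n$. This is a covariant functor from field extensions of $k$ to sets. Essential dimension: for a covariant functor $\mathcal{F}$ from the category of field extensions of $k$ to sets and $\alpha\in\mathcal{F}(K)$, $\operatorname{ed}(\alpha)$ is the minimum of $\operatorname{trdeg}_k K_0$ over all intermediate fields $k\subset K_0\subset K$ such that $\alpha$ lies in the image of $\mathcal{F}(K_0)\to\mathcal{F}(K)$. The generic point of $\mathcal{F}_E$ is the orbit $[x]=[(x_1,\dots,x_n)]\in\mathcal{F}_E(k(x_1,\dots,x_n))$, where $x_1,\dots,x_n$ are independent variables over $k$. *)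

theory Defs
  imports
    "HOL-Library.Poly_Mapping"
    "HOL-Library.Extended_Nat"
    "HOL-Computational_Algebra.Fraction_Field"
    "HOL-Computational_Algebra.Polynomial"
    "Jordan_Normal_Form.Matrix"
begin

section \<open>Subfields and transcendence degree\<close>

text \<open>
  Field extensions are represented as subfields (sets) of an ambient field type.
\<close>

definition is_subfield :: "'a::field set \<Rightarrow> bool" where
  "is_subfield K \<longleftrightarrow> 0 \<in> K \<and> 1 \<in> K \<and>
     (\<forall>x\<in>K. \<forall>y\<in>K. x + y \<in> K) \<and> (\<forall>x\<in>K. - x \<in> K) \<and>
     (\<forall>x\<in>K. \<forall>y\<in>K. x * y \<in> K) \<and> (\<forall>x\<in>K. inverse x \<in> K)"

text \<open>
  Polynomials with coefficients in \<open>'a\<close> and variables in \<open>'v\<close> are elements of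
  \<open>('v \<Rightarrow>\<^sub>0 nat) \<Rightarrow>\<^sub>0 'a\<close>; a monomial is its exponent vector \<open>'v \<Rightarrow>\<^sub>0 nat\<close>.
\<close>

definition mpoly_eval :: "('v \<Rightarrow> 'a::field) \<Rightarrow> (('v \<Rightarrow>\<^sub>0 nat) \<Rightarrow>\<^sub>0 'a) \<Rightarrow> 'a" where
  "mpoly_eval f p = (\<Sum>t\<in>Poly_Mapping.keys p. Poly_Mapping.lookup p t *
     (\<Prod>v\<in>Poly_Mapping.keys t. f v ^ Poly_Mapping.lookup t v))"

text \<open>
  The elements of \<open>S\<close> themselves serve as the names of the variables.
\<close>

definition alg_independent :: "'a::field set \<Rightarrow> 'a set \<Rightarrow> bool" where
  "alg_independent k S \<longleftrightarrow>
     (\<forall>p :: ('a \<Rightarrow>\<^sub>0 nat) \<Rightarrow>\<^sub>0 'a.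
        (\<forall>t. Poly_Mapping.lookup p t \<in> k) \<longrightarrow>
        (\<forall>t\<in>Poly_Mapping.keys p. Poly_Mapping.keys t \<subseteq> S) \<longrightarrow>
        mpoly_eval (\<lambda>s. s) p = 0 \<longrightarrow> p = 0)"

text \<open>
  The largest cardinality of an algebraically independent subset. It suffices to look at
  finite subsets, since subsets of independent sets are independent; the value is \<open>\<infinity>\<close>
  if there are arbitrarily large ones.
\<close>

definition trdeg :: "'a::field set \<Rightarrow> 'a set \<Rightarrow> enat" where
  "trdeg k L = (SUP S \<in> {S. S \<subseteq> L \<and> finite S \<and> alg_independent k S}. enat (card S))"


section \<open>Essential dimension\<close>

text \<open>
  A functor from field extensions of \<open>k\<close> to sets is given by its object part \<open>F\<close> and, for
  \<open>K0 \<subseteq> K\<close>, the maps \<open>\<iota> K0 K\<close> from \<open>F K0\<close> to \<open>F K\<close>. Only the values at intermediate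
  fields of \<open>K\<close> over \<open>k\<close> matter for the essential dimension of an element of \<open>F K\<close>.
  Since \<open>enat\<close> is well-ordered, the infimum is a minimum whenever \<open>\<alpha> \<in> F K\<close>, as
  \<open>K\<close> itself is then an admissible intermediate field.
\<close>

definition essential_dim ::
  "'a::field set \<Rightarrow> ('a set \<Rightarrow> 'b set) \<Rightarrow> ('a set \<Rightarrow> 'a set \<Rightarrow> 'b \<Rightarrow> 'b) \<Rightarrow> 'a set \<Rightarrow> 'b \<Rightarrow> enat"
where
  "essential_dim k F \<iota> K \<alpha> =
     Inf {trdeg k K0 | K0. is_subfield K0 \<and> k \<subseteq> K0 \<and> K0 \<subseteq> K \<and> \<alpha> \<in> \<iota> K0 K ` F K0}"


section \<open>The functor of torus orbits\<close>

definition coord_space :: "nat \<Rightarrow> 'a set \<Rightarrow> 'a vec set" where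
  "coord_space n K = {a \<in> carrier_vec n. \<forall>i<n. a $ i \<in> K}"

definition torus :: "nat \<Rightarrow> 'a::field set \<Rightarrow> 'a vec set" where
  "torus m K = coord_space m (K - {0})"

definition torus_act :: "int mat \<Rightarrow> 'a::field vec \<Rightarrow> 'a vec \<Rightarrow> 'a vec" where
  "torus_act E t a =
     vec (dim_row E) (\<lambda>i. a $ i * (\<Prod>j<dim_col E. (t $ j) powi (E $$ (i, j))))"

definition orbit_rel :: "int mat \<Rightarrow> 'a::field set \<Rightarrow> ('a vec \<times> 'a vec) set" where
  "orbit_rel E K =
     {(a, b). a \<in> coord_space (dim_row E) K \<and> (\<exists>t \<in> torus (dim_col E) K. b = torus_act E t a)}"

definition orbit_functor :: "int mat \<Rightarrow> 'a::field set \<Rightarrow> 'a vec set set" where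
  "orbit_functor E K = coord_space (dim_row E) K // orbit_rel E K"

text \<open>
  The map induced by \<open>K0\<^sup>n \<subseteq> K\<^sup>n\<close>: it sends a \<open>K0\<close>-orbit to the unique \<open>K\<close>-orbit containing
  it; see \<open>orbit_map_orbit\<close> below.
\<close>

definition orbit_map :: "int mat \<Rightarrow> 'a::field set \<Rightarrow> 'a set \<Rightarrow> 'a vec set \<Rightarrow> 'a vec set" where
  "orbit_map E K0 K X = orbit_rel E K `` X"

lemma is_subfield_prod:
  assumes "is_subfield K" "finite A" "\<And>i. i \<in> A \<Longrightarrow> f i \<in> K"
  shows "prod f A \<in> K"
  using assms(2,1,3) by (induction A rule: finite_induct) (auto simp: is_subfield_def)

lemma is_subfield_power: "is_subfield K \<Longrightarrow> x \<in> K \<Longrightarrow> x ^ n \<in> K"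
  by (induction n) (auto simp: is_subfield_def)

lemma is_subfield_powi: "is_subfield K \<Longrightarrow> x \<in> K \<Longrightarrow> x powi z \<in> K"
  by (auto simp: power_int_def is_subfield_power)
     (simp add: is_subfield_def is_subfield_power)

lemma torus_act_closed:
  assumes "is_subfield K" "t \<in> torus (dim_col E) K" "a \<in> coord_space (dim_row E) K"
  shows "torus_act E t a \<in> coord_space (dim_row E) K"
proof -
  have "(\<Prod>j<dim_col E. (t $ j) powi (E $$ (i, j))) \<in> K" for i
    using assms(1,2) by (intro is_subfield_prod is_subfield_powi) (auto simp: torus_def coord_space_def)
  thus ?thesis
    using assms(1,3) by (auto simp: coord_space_def torus_act_def is_subfield_def)
qed

lemma torus_act_one:
  assumes "a \<in> coord_space (dim_row E) K"
  shows "torus_act E (vec (dim_col E) (\<lambda>_. 1)) a = a"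
  using assms by (auto simp: torus_act_def coord_space_def intro!: eq_vecI)

lemma torus_act_mult:
  assumes "is_subfield K" "t \<in> torus (dim_col E) K" "s \<in> torus (dim_col E) K"
  shows "torus_act E s (torus_act E t a) =
           torus_act E (vec (dim_col E) (\<lambda>j. t $ j * s $ j)) a"
  by (auto simp: torus_act_def power_int_mult_distrib prod.distrib intro!: eq_vecI)

lemma equiv_orbit_rel:
  assumes K: "is_subfield K"
  shows "equiv (coord_space (dim_row E) K) (orbit_rel E K)"
proof (rule equivI)
  show "orbit_rel E K \<subseteq> coord_space (dim_row E) K \<times> coord_space (dim_row E) K"
    using torus_act_closed[OF K] by (auto simp: orbit_rel_def)
  have one: "vec (dim_col E) (\<lambda>_. 1) \<in> torus (dim_col E) K"
    using K by (auto simp: torus_def coord_space_def is_subfield_def)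
  show "refl_on (coord_space (dim_row E) K) (orbit_rel E K)"
    using one torus_act_one[of _ E K] torus_act_closed[OF K]
    by (force simp: refl_on_def orbit_rel_def)
  have mult: "vec (dim_col E) (\<lambda>j. t $ j * s $ j) \<in> torus (dim_col E) K"
    if "t \<in> torus (dim_col E) K" "s \<in> torus (dim_col E) K" for t s
    using that K by (auto simp: torus_def coord_space_def is_subfield_def)
  show "trans (orbit_rel E K)"
    using mult torus_act_mult[OF K] by (fastforce simp: trans_def orbit_rel_def)
  show "sym (orbit_rel E K)"
  proof (rule symI)
    fix a b assume "(a, b) \<in> orbit_rel E K"
    then obtain t where a: "a \<in> coord_space (dim_row E) K"
      and l: "t \<in> torus (dim_col E) K" and b: "b = torus_act E t a"
      by (auto simp: orbit_rel_def)
    let ?s = "vec (dim_col E) (\<lambda>j. inverse (t $ j))"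
    have m: "?s \<in> torus (dim_col E) K"
      using l K by (auto simp: torus_def coord_space_def is_subfield_def)
    have "vec (dim_col E) (\<lambda>j. t $ j * ?s $ j) = vec (dim_col E) (\<lambda>_. 1)"
      using l by (auto simp: torus_def coord_space_def intro!: eq_vecI)
    hence "torus_act E ?s b = a"
      using torus_act_mult[OF K l m, of a] torus_act_one[OF a] b by simp
    thus "(b, a) \<in> orbit_rel E K"
      using m b torus_act_closed[OF K l a] unfolding orbit_rel_def by fastforce
  qed
qed

lemma orbit_map_orbit:
  assumes "is_subfield K0" "is_subfield K" "K0 \<subseteq> K" "a \<in> coord_space (dim_row E) K0"
  shows "orbit_map E K0 K (orbit_rel E K0 `` {a}) = orbit_rel E K `` {a}"
proof -
  have sub: "orbit_rel E K0 \<subseteq> orbit_rel E K"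
    using assms(3) unfolding orbit_rel_def torus_def coord_space_def by fastforce
  have "(a, a) \<in> orbit_rel E K0"
    using equiv_orbit_rel[OF assms(1), of E] assms(4) by (auto simp: equiv_def refl_on_def)
  moreover have "trans (orbit_rel E K)"
    using equiv_orbit_rel[OF assms(2), of E] by (auto simp: equiv_def)
  ultimately show ?thesis
    using sub unfolding orbit_map_def by (blast dest: transD)
qed


section \<open>Rational functions and the generic point\<close>

text \<open>
  The ambient field is the field of fractions of the polynomial ring over \<open>'k\<close> in countably
  many variables \<open>x\<^sub>0, x\<^sub>1, \<dots>\<close>. The field \<open>k(x\<^sub>0, \<dots>, x\<^sub>n\<^sub>-\<^sub>1)\<close> is the set of fractions of
  polynomials in the first \<open>n\<close> of them.
\<close>

type_synonym 'k ratfun = "((nat \<Rightarrow>\<^sub>0 nat) \<Rightarrow>\<^sub>0 'k) fract"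

definition ratfun_const :: "'k::field \<Rightarrow> 'k ratfun" where
  "ratfun_const c = Fract (Poly_Mapping.single 0 c) 1"

definition ratfun_var :: "nat \<Rightarrow> 'k::field ratfun" where
  "ratfun_var i = Fract (Poly_Mapping.single (Poly_Mapping.single i 1) 1) 1"

definition polys_in :: "nat \<Rightarrow> ((nat \<Rightarrow>\<^sub>0 nat) \<Rightarrow>\<^sub>0 'k::field) set" where
  "polys_in n = {p. \<forall>t\<in>Poly_Mapping.keys p. Poly_Mapping.keys t \<subseteq> {..<n}}"

definition const_field :: "'k::field ratfun set" where
  "const_field = range ratfun_const"

definition ratfun_field :: "nat \<Rightarrow> 'k::field ratfun set" where
  "ratfun_field n = {Fract p q | p q. p \<in> polys_in n \<and> q \<in> polys_in n \<and> q \<noteq> 0}"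

definition generic_point :: "int mat \<Rightarrow> 'k::field ratfun vec set" where
  "generic_point E = orbit_rel E (ratfun_field (dim_row E)) `` {vec (dim_row E) ratfun_var}"

lemma polys_in_0: "0 \<in> polys_in n"
  and polys_in_single: "Poly_Mapping.keys t \<subseteq> {..<n} \<Longrightarrow> Poly_Mapping.single t c \<in> polys_in n"
  by (auto simp: polys_in_def)

lemma polys_in_1: "1 \<in> polys_in n"
  using polys_in_single[of 0 n 1] by simp

lemma polys_in_add: "p \<in> polys_in n \<Longrightarrow> q \<in> polys_in n \<Longrightarrow> p + q \<in> polys_in n"
  using Poly_Mapping.keys_add[of p q] unfolding polys_in_def by blast

lemma polys_in_uminus: "p \<in> polys_in n \<Longrightarrow> - p \<in> polys_in n"
  by (auto simp: polys_in_def)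

lemma polys_in_mult:
  assumes "p \<in> polys_in n" "q \<in> polys_in n"
  shows "p * q \<in> polys_in n"
  unfolding polys_in_def
proof (intro CollectI ballI)
  fix t assume "t \<in> Poly_Mapping.keys (p * q)"
  then obtain a b where "t = a + b" "a \<in> Poly_Mapping.keys p" "b \<in> Poly_Mapping.keys q"
    using keys_mult[of p q] by blast
  thus "Poly_Mapping.keys t \<subseteq> {..<n}"
    using assms Poly_Mapping.keys_add[of a b] unfolding polys_in_def by blast
qed

lemma ratfun_fieldI: "p \<in> polys_in n \<Longrightarrow> q \<in> polys_in n \<Longrightarrow> q \<noteq> 0 \<Longrightarrow> Fract p q \<in> ratfun_field n"
  unfolding ratfun_field_def by blast

lemma is_subfield_ratfun_field: "is_subfield (ratfun_field n :: 'k::field ratfun set)"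
  unfolding is_subfield_def
proof (intro conjI ballI)
  show "0 \<in> (ratfun_field n :: 'k ratfun set)" "1 \<in> (ratfun_field n :: 'k ratfun set)"
    by (auto simp: Zero_fract_def One_fract_def intro!: ratfun_fieldI polys_in_0 polys_in_1)
next
  fix x y :: "'k ratfun" assume "x \<in> ratfun_field n" "y \<in> ratfun_field n"
  then obtain p q r s where pqrs:
    "x = Fract p q" "y = Fract r s" "p \<in> polys_in n" "q \<in> polys_in n" "q \<noteq> 0"
    "r \<in> polys_in n" "s \<in> polys_in n" "s \<noteq> 0"
    by (auto simp: ratfun_field_def)
  have "x + y = Fract (p * s + r * q) (q * s)" "x * y = Fract (p * r) (q * s)"
    using pqrs by auto
  moreover have "q * s \<noteq> 0" using pqrs by simp
  moreover have "p * s + r * q \<in> polys_in n" "q * s \<in> polys_in n" "p * r \<in> polys_in n"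
    using pqrs by (auto intro!: polys_in_add polys_in_mult)
  ultimately show "x + y \<in> ratfun_field n" "x * y \<in> ratfun_field n"
    unfolding ratfun_field_def by blast+
next
  fix x :: "'k ratfun" assume "x \<in> ratfun_field n"
  then obtain p q where pq: "x = Fract p q" "p \<in> polys_in n" "q \<in> polys_in n" "q \<noteq> 0"
    by (auto simp: ratfun_field_def)
  have "- x = Fract (- p) q" using pq by simp
  thus "- x \<in> ratfun_field n" using pq polys_in_uminus unfolding ratfun_field_def by blast
  show "inverse x \<in> ratfun_field n"
  proof (cases "p = 0")
    case True
    hence "inverse x = Fract 0 1" using pq by (simp add: eq_fract)
    thus ?thesis by (auto intro!: ratfun_fieldI polys_in_0 polys_in_1)
  next
    case False
    thus ?thesis using pq by (auto intro: ratfun_fieldI)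
  qed
qed

lemma const_field_subset: "const_field \<subseteq> ratfun_field n"
  by (auto simp: const_field_def ratfun_const_def intro!: ratfun_fieldI polys_in_single polys_in_1)

lemma ratfun_var_in: "i < n \<Longrightarrow> ratfun_var i \<in> ratfun_field n"
  by (auto simp: ratfun_var_def intro!: ratfun_fieldI polys_in_single polys_in_1)


section \<open>Elementary divisors\<close>

definition smith_diag :: "nat \<Rightarrow> nat \<Rightarrow> int list \<Rightarrow> int mat" where
  "smith_diag n m ds = mat n m (\<lambda>(i, j). if i = j \<and> i < length ds then ds ! i else 0)"

text \<open>
  \<open>ds\<close> lists the positive diagonal entries \<open>d\<^sub>1 dvd \<dots> dvd d\<^sub>r\<close> of the Smith normal form of \<open>E\<close>.
  Invertibility of \<open>P\<close> and \<open>Q\<close> is over the integers.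
\<close>

definition elementary_divisors :: "int mat \<Rightarrow> int list \<Rightarrow> bool" where
  "elementary_divisors E ds \<longleftrightarrow>
     length ds \<le> min (dim_row E) (dim_col E) \<and> (\<forall>d\<in>set ds. d > 0) \<and> sorted_wrt (dvd) ds \<and>
     (\<exists>P Q. P \<in> carrier_mat (dim_row E) (dim_row E) \<and> Q \<in> carrier_mat (dim_col E) (dim_col E) \<and>
        invertible_mat P \<and> invertible_mat Q \<and>
        P * E * Q = smith_diag (dim_row E) (dim_col E) ds)"

end

theory Submission
  imports Defs
begin

text \<open>
  Let \<open>P * E * Q = D\<close> be the Smith normal form.  The orbit of the generic point comes from \<open>K0\<close> iff
  some \<open>a = t \<cdot> x\<close> has all its coordinates in \<open>K0\<close>.  The monomial substitutions by \<open>P\<close> and \<open>Q\<close> are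
  invertible and do not change the fields involved; they replace \<open>x\<close> by the Laurent monomials
  \<open>y\<^sub>i = \<Prod>\<^sub>j x\<^sub>j ^ P\<^sub>i\<^sub>j\<close> and turn the action into \<open>y\<^sub>i \<mapsto> y\<^sub>i * \<mu>\<^sub>i ^ d\<^sub>i\<close>, where \<open>d\<^sub>i = 0\<close>
  for \<open>i\<close> beyond the rank.  Thus the question is how small the transcendence degree of a field
  containing such elements \<open>y\<^sub>i * \<mu>\<^sub>i ^ d\<^sub>i\<close> can be.

  Upper bound (\<open>orbit_meets_small_field\<close>): where \<open>d\<^sub>i = 1\<close>, the choice \<open>\<mu>\<^sub>i = 1 / y\<^sub>i\<close> makes the
  \<open>i\<close>-th coordinate equal to \<open>1\<close>, and the field generated by the remaining \<open>n - l\<close> coordinates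
  has transcendence degree at most \<open>n - l\<close> by a counting argument (\<open>trdeg_gen_field_le\<close>).

  Lower bound (\<open>trdeg_ge_if_orbit_meets\<close>): the other \<open>n - l\<close> coordinates are always algebraically
  independent.  Consider the degree \<open>K\<^sup>* \<rightarrow> \<int>\<^sup>n\<close> given by the lexicographically leading exponent
  vector.  Let \<open>d > 1\<close> divide all \<open>d\<^sub>i\<close> other than \<open>1\<close>.  Then the degree of \<open>y\<^sub>i * \<mu>\<^sub>i ^ d\<^sub>i\<close>
  is congruent modulo \<open>d\<close> to that of \<open>y\<^sub>i\<close>, which is the \<open>i\<close>-th row of the invertible matrix
  \<open>P\<close>.  Hence these degrees are linearly independent (\<open>rows_independent_mod\<close>), and elements with
  linearly independent degrees satisfy no algebraic relation, as their monomials have distinct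
  degrees and cannot cancel (\<open>alg_independent_if_degs_independent\<close>).
\<close>

section \<open>Leading exponents of polynomials\<close>

text \<open>
  The order on \<open>nat \<Rightarrow>\<^sub>0 nat\<close> is lexicographic, so this is the multidegree for the lexicographic
  monomial order.  It is meaningless for \<open>0\<close>.
\<close>

definition lead_exp :: "((nat \<Rightarrow>\<^sub>0 nat) \<Rightarrow>\<^sub>0 'a::zero) \<Rightarrow> nat \<Rightarrow>\<^sub>0 nat" where
  "lead_exp p = Max (Poly_Mapping.keys p)"

lemma lead_exp_in_keys: "p \<noteq> 0 \<Longrightarrow> lead_exp p \<in> Poly_Mapping.keys p"
  unfolding lead_exp_def by (rule Max_in) auto

lemma keys_le_lead_exp: "t \<in> Poly_Mapping.keys p \<Longrightarrow> t \<le> lead_exp p"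
  unfolding lead_exp_def by (rule Max_ge) auto

text \<open>
  The order on exponents is total and compatible with addition, so in a product the two leading
  terms give the only contribution to the largest exponent, and its coefficient is a product of
  nonzero elements.
\<close>

lemma lead_exp_mult:
  fixes p q :: "(nat \<Rightarrow>\<^sub>0 nat) \<Rightarrow>\<^sub>0 'a::idom"
  assumes "p \<noteq> 0" "q \<noteq> 0"
  shows "lead_exp (p * q) = lead_exp p + lead_exp q"
proof -
  \<comment> \<open>\<open>a\<close> and \<open>b\<close> are the leading terms\<close>
  define a where "a = Poly_Mapping.single (lead_exp p) (Poly_Mapping.lookup p (lead_exp p))"
  define b where "b = Poly_Mapping.single (lead_exp q) (Poly_Mapping.lookup q (lead_exp q))"
  have small_p: "t < lead_exp p" if "t \<in> Poly_Mapping.keys (p - a)" for t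
  proof -
    have "t \<noteq> lead_exp p" "t \<in> Poly_Mapping.keys p"
      using that by (auto simp: a_def in_keys_iff lookup_minus lookup_single when_def split: if_splits)
    thus ?thesis using keys_le_lead_exp by (simp add: order_less_le)
  qed
  have small_q: "t < lead_exp q" if "t \<in> Poly_Mapping.keys (q - b)" for t
  proof -
    have "t \<noteq> lead_exp q" "t \<in> Poly_Mapping.keys q"
      using that by (auto simp: b_def in_keys_iff lookup_minus lookup_single when_def split: if_splits)
    thus ?thesis using keys_le_lead_exp by (simp add: order_less_le)
  qed
  have "lead_exp p + lead_exp q \<notin> Poly_Mapping.keys ((p - a) * q)"
  proof
    assume "lead_exp p + lead_exp q \<in> Poly_Mapping.keys ((p - a) * q)"
    then obtain s t where st: "lead_exp p + lead_exp q = s + t"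
      "s \<in> Poly_Mapping.keys (p - a)" "t \<in> Poly_Mapping.keys q"
      using keys_mult[of "p - a" q] by blast
    have "s + t < lead_exp p + lead_exp q"
      using small_p[OF st(2)] keys_le_lead_exp[OF st(3)] by (rule add_less_le_mono)
    thus False using st(1) by simp
  qed
  moreover have "lead_exp p + lead_exp q \<notin> Poly_Mapping.keys (a * (q - b))"
  proof
    assume "lead_exp p + lead_exp q \<in> Poly_Mapping.keys (a * (q - b))"
    then obtain s t where st: "lead_exp p + lead_exp q = s + t"
      "s \<in> Poly_Mapping.keys a" "t \<in> Poly_Mapping.keys (q - b)"
      using keys_mult[of a "q - b"] by blast
    have "s = lead_exp p" using st(2) by (auto simp: a_def split: if_splits)
    thus False using small_q[OF st(3)] st(1) by simp
  qed
  moreover have "p * q = a * b + (p - a) * q + a * (q - b)" by (simp add: algebra_simps)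
  ultimately have "Poly_Mapping.lookup (p * q) (lead_exp p + lead_exp q)
      = Poly_Mapping.lookup (a * b) (lead_exp p + lead_exp q)"
    by (simp add: lookup_add in_keys_iff)
  also have "\<dots> \<noteq> 0"
    using lead_exp_in_keys[OF assms(1)] lead_exp_in_keys[OF assms(2)]
    by (simp add: a_def b_def mult_single in_keys_iff)
  finally have "lead_exp p + lead_exp q \<in> Poly_Mapping.keys (p * q)" by (simp add: in_keys_iff)
  moreover have "t \<le> lead_exp p + lead_exp q" if t: "t \<in> Poly_Mapping.keys (p * q)" for t
  proof -
    obtain u v where "t = u + v" "u \<in> Poly_Mapping.keys p" "v \<in> Poly_Mapping.keys q"
      using t keys_mult[of p q] by blast
    thus ?thesis using keys_le_lead_exp add_mono by metis
  qed
  ultimately show ?thesis unfolding lead_exp_def[of "p * q"] by (intro Max_eqI) auto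
qed

text \<open>
  The largest of the leading exponents is attained by one summand only, so its coefficient cannot
  cancel.
\<close>

lemma sum_nonzero_if_lead_exp_inj:
  assumes "finite T" "T \<noteq> {}" "\<And>t. t \<in> T \<Longrightarrow> f t \<noteq> 0" "inj_on (\<lambda>t. lead_exp (f t)) T"
  shows "sum f T \<noteq> (0 :: (nat \<Rightarrow>\<^sub>0 nat) \<Rightarrow>\<^sub>0 'a::comm_monoid_add)"
proof -
  define M where "M = Max ((\<lambda>t. lead_exp (f t)) ` T)"
  have "M \<in> (\<lambda>t. lead_exp (f t)) ` T" unfolding M_def using assms by (intro Max_in) auto
  then obtain s where s: "s \<in> T" "lead_exp (f s) = M" by auto
  have "Poly_Mapping.lookup (f t) M = 0" if t: "t \<in> T - {s}" for t
  proof (rule ccontr)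
    assume "Poly_Mapping.lookup (f t) M \<noteq> 0"
    hence "M \<le> lead_exp (f t)" by (intro keys_le_lead_exp) (simp add: in_keys_iff)
    moreover have "lead_exp (f t) \<le> M" using t assms(1) unfolding M_def by (intro Max_ge) auto
    ultimately have "lead_exp (f t) = lead_exp (f s)" using s by simp
    thus False using inj_onD[OF assms(4)] t s(1) by auto
  qed
  hence "Poly_Mapping.lookup (sum f T) M = Poly_Mapping.lookup (f s) M"
    by (simp add: lookup_sum lookup_add sum.remove[OF assms(1) s(1)])
  also have "\<dots> \<noteq> 0" using lead_exp_in_keys[OF assms(3)[OF s(1)]] s(2) by (simp add: in_keys_iff)
  finally show ?thesis by auto
qed

lemma single_eq_0_iff: "Poly_Mapping.single t c = 0 \<longleftrightarrow> c = 0"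
  by (metis lookup_single_eq lookup_zero single_zero)

lemma lead_exp_single: "c \<noteq> 0 \<Longrightarrow> lead_exp (Poly_Mapping.single t c) = t"
  by (simp add: lead_exp_def)

lemma lead_exp_1: "lead_exp (1 :: (nat \<Rightarrow>\<^sub>0 nat) \<Rightarrow>\<^sub>0 'k::field) = 0"
  using lead_exp_single[of "1::'k" 0] by simp

section \<open>The degree of a rational function\<close>

text \<open>
  The extension of the leading exponent from polynomials to fractions.  It is a homomorphism from
  the multiplicative group to integer vectors, the negative of a valuation.  All representations
  as a fraction give the same value, by multiplicativity of the leading exponent.
\<close>

definition ratfun_deg :: "'k::field ratfun \<Rightarrow> nat \<Rightarrow> int" where
  "ratfun_deg x = (SOME v. \<exists>p q. p \<noteq> 0 \<and> q \<noteq> 0 \<and> x = Fract p q \<and>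
     v = (\<lambda>i. int (Poly_Mapping.lookup (lead_exp p) i) - int (Poly_Mapping.lookup (lead_exp q) i)))"

lemma ratfun_deg_Fract:
  fixes p q :: "(nat \<Rightarrow>\<^sub>0 nat) \<Rightarrow>\<^sub>0 'k::field"
  assumes "p \<noteq> 0" "q \<noteq> 0"
  shows "ratfun_deg (Fract p q) i =
    int (Poly_Mapping.lookup (lead_exp p) i) - int (Poly_Mapping.lookup (lead_exp q) i)"
proof -
  let ?d = "\<lambda>(p :: (nat \<Rightarrow>\<^sub>0 nat) \<Rightarrow>\<^sub>0 'k) q i.
    int (Poly_Mapping.lookup (lead_exp p) i) - int (Poly_Mapping.lookup (lead_exp q) i)"
  have "\<exists>v r s. r \<noteq> 0 \<and> s \<noteq> 0 \<and> Fract p q = Fract r s \<and> v = ?d r s" using assms by blast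
  hence "\<exists>r s. r \<noteq> 0 \<and> s \<noteq> 0 \<and> Fract p q = Fract r s \<and> ratfun_deg (Fract p q) = ?d r s"
    unfolding ratfun_deg_def by (rule someI_ex)
  then obtain r s where rs: "r \<noteq> 0" "s \<noteq> 0" "Fract p q = Fract r s"
    "ratfun_deg (Fract p q) = ?d r s" by blast
  have "p * s = r * q" using rs assms by (simp add: eq_fract)
  hence "lead_exp p + lead_exp s = lead_exp r + lead_exp q"
    using lead_exp_mult[of p s] lead_exp_mult[of r q] assms rs by simp
  hence "Poly_Mapping.lookup (lead_exp p + lead_exp s) i
    = Poly_Mapping.lookup (lead_exp r + lead_exp q) i" by simp
  thus ?thesis by (simp add: rs(4) lookup_add)
qed

lemma nonzero_fractE:
  fixes x :: "'a::idom fract"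
  assumes "x \<noteq> 0"
  obtains p q where "x = Fract p q" "p \<noteq> 0" "q \<noteq> 0"
  using assms by (cases x) (auto simp: Zero_fract_def eq_fract)

lemma ratfun_var_neq_0: "ratfun_var j \<noteq> (0 :: 'k::field ratfun)"
  by (simp add: ratfun_var_def Zero_fract_def eq_fract single_eq_0_iff)

lemma ratfun_deg_const: "c \<noteq> 0 \<Longrightarrow> ratfun_deg (ratfun_const c) i = 0"
  by (subst ratfun_const_def, subst ratfun_deg_Fract) (simp_all add: lead_exp_single lead_exp_1 single_eq_0_iff)

lemma ratfun_deg_1: "ratfun_deg (1 :: 'k::field ratfun) i = 0"
  using ratfun_deg_const[of "1::'k" i] by (simp add: ratfun_const_def One_fract_def)

lemma ratfun_deg_var: "ratfun_deg (ratfun_var j :: 'k::field ratfun) i = (if i = j then 1 else 0)"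
  unfolding ratfun_var_def
  by (subst ratfun_deg_Fract) (simp_all add: lead_exp_single lead_exp_1 single_eq_0_iff lookup_single when_def)

lemma ratfun_deg_mult:
  fixes x y :: "'k::field ratfun"
  assumes "x \<noteq> 0" "y \<noteq> 0"
  shows "ratfun_deg (x * y) i = ratfun_deg x i + ratfun_deg y i"
proof -
  obtain p q r s where *: "x = Fract p q" "p \<noteq> 0" "q \<noteq> 0" "y = Fract r s" "r \<noteq> 0" "s \<noteq> 0"
    using nonzero_fractE[OF assms(1)] nonzero_fractE[OF assms(2)] by metis
  thus ?thesis by (simp add: ratfun_deg_Fract lead_exp_mult lookup_add)
qed

lemma ratfun_deg_power: "x \<noteq> 0 \<Longrightarrow> ratfun_deg (x ^ e) i = int e * ratfun_deg x i"
  by (induction e) (simp_all add: ratfun_deg_1 ratfun_deg_mult algebra_simps)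

lemma ratfun_deg_inverse:
  fixes x :: "'k::field ratfun"
  assumes "x \<noteq> 0"
  shows "ratfun_deg (inverse x) i = - ratfun_deg x i"
  using ratfun_deg_mult[of x "inverse x" i] assms by (simp add: ratfun_deg_1)

lemma ratfun_deg_powi: "x \<noteq> 0 \<Longrightarrow> ratfun_deg (x powi e) i = e * ratfun_deg x i"
  by (auto simp: power_int_def ratfun_deg_power ratfun_deg_inverse)

lemma ratfun_deg_prod:
  fixes f :: "'b \<Rightarrow> 'k::field ratfun"
  assumes "finite A" "\<And>a. a \<in> A \<Longrightarrow> f a \<noteq> 0"
  shows "ratfun_deg (prod f A) i = (\<Sum>a\<in>A. ratfun_deg (f a) i)"
  using assms by (induction A rule: finite_induct) (simp_all add: ratfun_deg_1 ratfun_deg_mult)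

lemma common_denominator:
  fixes f :: "'b \<Rightarrow> 'a::idom fract"
  assumes "finite T"
  shows "\<exists>q. q \<noteq> 0 \<and> (\<forall>t\<in>T. \<exists>p. f t = Fract p q)"
  using assms
proof (induction T rule: finite_induct)
  case empty
  thus ?case by (auto intro: exI[of _ 1])
next
  case (insert u T)
  then obtain q where q: "q \<noteq> 0" "\<forall>t\<in>T. \<exists>p. f t = Fract p q" by blast
  obtain r s where rs: "f u = Fract r s" "s \<noteq> 0" by (cases "f u")
  have "\<exists>p. f t = Fract p (q * s)" if "t \<in> insert u T" for t
  proof (cases "t = u")
    case True
    hence "f t = Fract (q * r) (q * s)" using rs q by (simp add: eq_fract)
    thus ?thesis ..
  next
    case False
    hence "t \<in> T" using that by simp
    then obtain p where "f t = Fract p q" using q(2) by blast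
    hence "f t = Fract (p * s) (q * s)" using rs q by (simp add: eq_fract)
    thus ?thesis ..
  qed
  thus ?case using q rs by (intro exI[of _ "q * s"]) simp
qed

lemma sum_Fract:
  fixes q :: "'a::idom"
  assumes "finite T" "q \<noteq> 0"
  shows "(\<Sum>t\<in>T. Fract (p t) q) = Fract (sum p T) q"
  using assms(1)
proof (induction T rule: finite_induct)
  case empty
  thus ?case using assms(2) by (simp add: Zero_fract_def eq_fract)
next
  case (insert t T)
  thus ?case using assms(2) by (simp add: eq_fract algebra_simps)
qed

text \<open>
  Over a common denominator, distinct degrees of the fractions are distinct leading exponents of
  the numerators.  This avoids ordering the exponent vectors with negative entries.
\<close>

lemma sum_nonzero_if_ratfun_deg_inj:
  fixes f :: "'b \<Rightarrow> 'k::field ratfun"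
  assumes "finite T" "T \<noteq> {}" "\<And>t. t \<in> T \<Longrightarrow> f t \<noteq> 0" "inj_on (\<lambda>t. ratfun_deg (f t)) T"
  shows "sum f T \<noteq> 0"
proof -
  obtain q p where q: "q \<noteq> 0" and p: "\<And>t. t \<in> T \<Longrightarrow> f t = Fract (p t) q"
    using common_denominator[OF assms(1), of f] by metis
  have p0: "p t \<noteq> 0" if "t \<in> T" for t
    using p[OF that] assms(3)[OF that] q by (auto simp: Zero_fract_def eq_fract)
  have "inj_on (\<lambda>t. lead_exp (p t)) T"
  proof (rule inj_onI)
    fix s t assume st: "s \<in> T" "t \<in> T" "lead_exp (p s) = lead_exp (p t)"
    have "ratfun_deg (f s) = ratfun_deg (f t)"
      using st p0 p q by (auto simp: fun_eq_iff ratfun_deg_Fract)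
    thus "s = t" using inj_onD[OF assms(4)] st by auto
  qed
  hence "sum p T \<noteq> 0" using sum_nonzero_if_lead_exp_inj[of T p] assms p0 by blast
  moreover have "sum f T = Fract (sum p T) q"
    using sum_Fract[OF assms(1) q, of p] p by simp
  ultimately show ?thesis using q by (simp add: Zero_fract_def eq_fract)
qed

section \<open>Algebraic independence from degrees\<close>

text \<open>
  The degree of a monomial in the elements of \<open>S\<close> is the corresponding integer combination of their
  degrees.  So distinct monomials have distinct degrees, whatever their nonzero constant
  coefficients, and a nontrivial sum of them cannot vanish.
\<close>

lemma alg_independent_if_degs_independent:
  fixes S :: "'k::field ratfun set"
  assumes "finite S" "0 \<notin> S"
    and indep: "\<And>c. (\<And>i. (\<Sum>s\<in>S. c s * ratfun_deg s i) = 0) \<Longrightarrow> \<forall>s\<in>S. c s = 0"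
  shows "alg_independent const_field S"
  unfolding alg_independent_def
proof (intro allI impI)
  fix p :: "('k ratfun \<Rightarrow>\<^sub>0 nat) \<Rightarrow>\<^sub>0 'k ratfun"
  assume coeffs: "\<forall>t. Poly_Mapping.lookup p t \<in> const_field"
    and vars: "\<forall>t\<in>Poly_Mapping.keys p. Poly_Mapping.keys t \<subseteq> S"
    and zero: "mpoly_eval (\<lambda>s. s) p = 0"
  define term_of where "term_of t = Poly_Mapping.lookup p t *
    (\<Prod>v\<in>Poly_Mapping.keys t. v ^ Poly_Mapping.lookup t v)" for t
  have nz: "term_of t \<noteq> 0" if "t \<in> Poly_Mapping.keys p" for t
  proof -
    have "0 \<notin> Poly_Mapping.keys t" using that vars assms(2) by blast
    moreover have "Poly_Mapping.lookup p t \<noteq> 0" using that by (simp add: in_keys_iff)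
    ultimately show ?thesis by (auto simp: term_of_def in_keys_iff)
  qed
  have deg: "ratfun_deg (term_of t) i = (\<Sum>s\<in>S. int (Poly_Mapping.lookup t s) * ratfun_deg s i)"
    if t: "t \<in> Poly_Mapping.keys p" for t i
  proof -
    have sub: "Poly_Mapping.keys t \<subseteq> S" using vars t by blast
    hence nz': "\<And>v. v \<in> Poly_Mapping.keys t \<Longrightarrow> v \<noteq> 0" using assms(2) by auto
    obtain c where c: "Poly_Mapping.lookup p t = ratfun_const c"
      using coeffs by (auto simp: const_field_def)
    have "Poly_Mapping.lookup p t \<noteq> 0" using t by (simp add: in_keys_iff)
    moreover from this have "c \<noteq> 0" using c by (auto simp: ratfun_const_def Zero_fract_def)
    ultimately have "ratfun_deg (term_of t) i
      = (\<Sum>s\<in>Poly_Mapping.keys t. int (Poly_Mapping.lookup t s) * ratfun_deg s i)"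
      using nz' unfolding term_of_def
      by (subst ratfun_deg_mult) (simp_all add: c ratfun_deg_const ratfun_deg_prod ratfun_deg_power)
    also have "\<dots> = (\<Sum>s\<in>S. int (Poly_Mapping.lookup t s) * ratfun_deg s i)"
      using sub assms(1) by (intro sum.mono_neutral_left) (auto simp: in_keys_iff)
    finally show ?thesis .
  qed
  have "inj_on (\<lambda>t. ratfun_deg (term_of t)) (Poly_Mapping.keys p)"
  proof (rule inj_onI)
    fix t u assume tu: "t \<in> Poly_Mapping.keys p" "u \<in> Poly_Mapping.keys p"
      "ratfun_deg (term_of t) = ratfun_deg (term_of u)"
    have "(\<Sum>s\<in>S. (int (Poly_Mapping.lookup t s) - int (Poly_Mapping.lookup u s)) * ratfun_deg s i) = 0" for i
      using fun_cong[OF tu(3), of i] deg[OF tu(1)] deg[OF tu(2)]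
      by (simp add: sum_subtractf left_diff_distrib)
    hence "\<forall>s\<in>S. int (Poly_Mapping.lookup t s) - int (Poly_Mapping.lookup u s) = 0" by (rule indep)
    moreover have "Poly_Mapping.lookup t s = 0 \<and> Poly_Mapping.lookup u s = 0" if "s \<notin> S" for s
    proof -
      have "s \<notin> Poly_Mapping.keys t" "s \<notin> Poly_Mapping.keys u" using that tu(1,2) vars by blast+
      thus ?thesis by (simp add: in_keys_iff)
    qed
    ultimately have "Poly_Mapping.lookup t s = Poly_Mapping.lookup u s" for s
      by (cases "s \<in> S") auto
    thus "t = u" by (rule poly_mapping_eqI)
  qed
  moreover have "sum term_of (Poly_Mapping.keys p) = 0"
    using zero by (simp add: mpoly_eval_def term_of_def)
  ultimately have "Poly_Mapping.keys p = {}"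
    using sum_nonzero_if_ratfun_deg_inj[of "Poly_Mapping.keys p" term_of] nz by auto
  thus "p = 0" by simp
qed

text \<open>
  If two members of the family coincided, the difference of their unit vectors would be a
  linear relation between the degrees.
\<close>

lemma alg_independent_family:
  fixes b :: "'b \<Rightarrow> 'k::field ratfun"
  assumes "finite I" "\<And>i. i \<in> I \<Longrightarrow> b i \<noteq> 0"
    and indep: "\<And>z. (\<And>c. (\<Sum>i\<in>I. z i * ratfun_deg (b i) c) = 0) \<Longrightarrow> \<forall>i\<in>I. z i = 0"
  shows "inj_on b I" "alg_independent const_field (b ` I)"
proof -
  show inj: "inj_on b I"
  proof (rule inj_onI, rule ccontr)
    fix i j assume ij: "i \<in> I" "j \<in> I" "b i = b j" "i \<noteq> j"
    \<comment> \<open>the relation \<open>deg (b i) - deg (b j) = 0\<close>\<close>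
    define z :: "'b \<Rightarrow> int" where "z h = (if h = i then 1 else if h = j then - 1 else 0)" for h
    have "(\<Sum>h\<in>I. z h * ratfun_deg (b h) c) = 0" for c
    proof -
      have "(\<Sum>h\<in>I. z h * ratfun_deg (b h) c) = (\<Sum>h\<in>{i, j}. z h * ratfun_deg (b h) c)"
        using assms(1) ij by (intro sum.mono_neutral_right) (auto simp: z_def)
      also have "\<dots> = 0" using ij by (simp add: z_def)
      finally show ?thesis .
    qed
    from indep[OF this] ij(1) have "z i = 0" by blast
    thus False by (simp add: z_def)
  qed
  show "alg_independent const_field (b ` I)"
  proof (rule alg_independent_if_degs_independent)
    show "finite (b ` I)" "0 \<notin> b ` I" using assms(1,2) by force+
    fix c :: "'k ratfun \<Rightarrow> int"
    assume "\<And>i. (\<Sum>s\<in>b ` I. c s * ratfun_deg s i) = 0"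
    hence "\<forall>i\<in>I. c (b i) = 0"
      by (intro indep) (simp add: sum.reindex[OF inj])
    thus "\<forall>s\<in>b ` I. c s = 0" by simp
  qed
qed

lemma trdeg_ge_family:
  assumes "finite I" "b ` I \<subseteq> L" "inj_on b I" "alg_independent k (b ` I)"
  shows "enat (card I) \<le> trdeg k L"
proof -
  have "enat (card (b ` I)) \<le> trdeg k L"
    unfolding trdeg_def using assms by (intro SUP_upper) auto
  thus ?thesis using card_image[OF assms(3)] by simp
qed

section \<open>Finitely generated fields of rational functions\<close>

text \<open>
  A version of the dimension bound for families, in which the values \<open>f t\<close> may repeat.
\<close>

lemma (in vector_space) linear_relation_if_card_gt:
  assumes "finite T" "finite B" "f ` T \<subseteq> span B" "card B < card T"
  obtains c where "\<exists>t\<in>T. c t \<noteq> 0" "(\<Sum>t\<in>T. scale (c t) (f t)) = 0"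
proof (cases "inj_on f T")
  case True
  have "dependent (f ` T)"
    using independent_span_bound[OF assms(2) _ assms(3)] assms(4) card_image[OF True] by force
  then obtain u where "\<exists>v\<in>f ` T. u v \<noteq> 0" "(\<Sum>v\<in>f ` T. scale (u v) v) = 0"
    using dependent_finite[of "f ` T"] assms(1) by auto
  thus ?thesis using that[of "u \<circ> f"] by (auto simp: sum.reindex[OF True])
next
  case False
  then obtain s t where st: "s \<in> T" "t \<in> T" "s \<noteq> t" "f s = f t" by (auto simp: inj_on_def)
  let ?c = "\<lambda>r. if r = s then 1 else if r = t then - 1 else (0 :: 'a)"
  have "(\<Sum>r\<in>T. scale (?c r) (f r)) = (\<Sum>r\<in>{s, t}. scale (?c r) (f r))"
    using st assms(1) by (intro sum.mono_neutral_right) auto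
  also have "\<dots> = 0" using st by simp
  finally have "(\<Sum>r\<in>T. scale (?c r) (f r)) = 0" .
  moreover have "\<exists>r\<in>T. ?c r \<noteq> 0" using st(1) by (intro bexI[of _ s]) auto
  ultimately show ?thesis by (rule that[rotated])
qed

text \<open>
  Algebraic independence in terms of exponent functions on \<open>S\<close> instead of polynomial objects: the
  coefficients of a vanishing linear combination of monomials are those of a polynomial that
  vanishes at \<open>S\<close>.  Exponent functions are extensional on \<open>S\<close> to make them correspond bijectively
  to monomials.
\<close>

lemma alg_independentD:
  assumes ind: "alg_independent k S" and "finite S" "0 \<in> k"
    and T: "finite T" "T \<subseteq> S \<rightarrow>\<^sub>E UNIV" and c: "\<And>\<phi>. \<phi> \<in> T \<Longrightarrow> c \<phi> \<in> k"
    and zero: "(\<Sum>\<phi>\<in>T. c \<phi> * (\<Prod>s\<in>S. s ^ \<phi> s)) = 0" and "\<phi> \<in> T"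
  shows "c \<phi> = 0"
proof -
  define ex :: "('a \<Rightarrow> nat) \<Rightarrow> 'a \<Rightarrow>\<^sub>0 nat" where "ex \<phi> = (\<Sum>s\<in>S. Poly_Mapping.single s (\<phi> s))" for \<phi>
  have lookup_ex: "Poly_Mapping.lookup (ex \<phi>) s = (if s \<in> S then \<phi> s else 0)" for \<phi> s
    using assms(2) by (simp add: ex_def lookup_sum lookup_single when_def)
  have inj: "inj_on ex T"
  proof (rule inj_onI)
    fix \<phi> \<psi> assume *: "\<phi> \<in> T" "\<psi> \<in> T" "ex \<phi> = ex \<psi>"
    show "\<phi> = \<psi>"
    proof (rule PiE_ext)
      show "\<phi> \<in> S \<rightarrow>\<^sub>E UNIV" "\<psi> \<in> S \<rightarrow>\<^sub>E UNIV" using * T by auto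
      show "\<phi> s = \<psi> s" if "s \<in> S" for s
        using lookup_ex[of \<phi> s] lookup_ex[of \<psi> s] *(3) that by simp
    qed
  qed
  define p where "p = (\<Sum>\<phi>\<in>T. Poly_Mapping.single (ex \<phi>) (c \<phi>))"
  have lookup_p: "Poly_Mapping.lookup p (ex \<phi>) = c \<phi>" if "\<phi> \<in> T" for \<phi>
  proof -
    have "Poly_Mapping.lookup p (ex \<phi>) = (\<Sum>\<psi>\<in>T. if \<psi> = \<phi> then c \<psi> else 0)"
      unfolding p_def lookup_sum lookup_single when_def
      using inj_on_eq_iff[OF inj _ that] by (intro sum.cong) auto
    thus ?thesis using T(1) that by simp
  qed
  have lookup_p0: "Poly_Mapping.lookup p t = 0" if "t \<notin> ex ` T" for t
    using that unfolding p_def lookup_sum lookup_single when_def by (intro sum.neutral) auto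
  hence keys_p: "Poly_Mapping.keys p \<subseteq> ex ` T" by (auto simp: in_keys_iff)
  have "\<forall>t. Poly_Mapping.lookup p t \<in> k"
    using lookup_p lookup_p0 c assms(3) by (metis imageE)
  moreover have "\<forall>t\<in>Poly_Mapping.keys p. Poly_Mapping.keys t \<subseteq> S"
    using keys_p by (auto simp: in_keys_iff lookup_ex split: if_splits)
  moreover have "mpoly_eval (\<lambda>s. s) p = 0"
  proof -
    have "mpoly_eval (\<lambda>s. s) p = (\<Sum>t\<in>ex ` T. Poly_Mapping.lookup p t *
        (\<Prod>v\<in>Poly_Mapping.keys t. v ^ Poly_Mapping.lookup t v))"
      unfolding mpoly_eval_def using T(1) keys_p
      by (intro sum.mono_neutral_left) (auto simp: in_keys_iff)
    also have "\<dots> = (\<Sum>\<phi>\<in>T. c \<phi> * (\<Prod>v\<in>Poly_Mapping.keys (ex \<phi>). v ^ Poly_Mapping.lookup (ex \<phi>) v))"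
      using lookup_p by (simp add: sum.reindex[OF inj])
    also have "\<dots> = (\<Sum>\<phi>\<in>T. c \<phi> * (\<Prod>s\<in>S. s ^ \<phi> s))"
    proof (intro sum.cong refl arg_cong2[where f = "(*)"])
      fix \<phi>
      have "(\<Prod>v\<in>Poly_Mapping.keys (ex \<phi>). v ^ Poly_Mapping.lookup (ex \<phi>) v)
        = (\<Prod>v\<in>S. v ^ Poly_Mapping.lookup (ex \<phi>) v)"
        using assms(2)
        by (intro prod.mono_neutral_left) (auto simp: in_keys_iff lookup_ex split: if_splits)
      also have "\<dots> = (\<Prod>s\<in>S. s ^ \<phi> s)" by (intro prod.cong) (auto simp: lookup_ex)
      finally show "(\<Prod>v\<in>Poly_Mapping.keys (ex \<phi>). v ^ Poly_Mapping.lookup (ex \<phi>) v)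
        = (\<Prod>s\<in>S. s ^ \<phi> s)" .
    qed
    finally show ?thesis using zero by simp
  qed
  ultimately have "p = 0" using ind unfolding alg_independent_def by blast
  thus ?thesis using lookup_p[OF \<open>\<phi> \<in> T\<close>] by simp
qed

lemma ratfun_const_0: "ratfun_const 0 = 0"
  and ratfun_const_1: "ratfun_const 1 = 1"
  and ratfun_const_add: "ratfun_const (c + d) = ratfun_const c + ratfun_const d"
  and ratfun_const_mult: "ratfun_const (c * d) = ratfun_const c * ratfun_const d"
  by (simp_all add: ratfun_const_def Zero_fract_def One_fract_def single_add mult_single)

lemma ratfun_const_eq_0_iff: "ratfun_const c = 0 \<longleftrightarrow> c = 0"
  by (simp add: ratfun_const_def Zero_fract_def eq_fract single_eq_0_iff)

interpretation ratfun_vs: vector_space "\<lambda>c (x :: 'k::field ratfun). ratfun_const c * x"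
  by unfold_locales
    (simp_all add: ratfun_const_1 ratfun_const_add ratfun_const_mult algebra_simps)

text \<open>
  Polynomial expressions in the elements \<open>y h\<close>, with exponent at most \<open>e\<close> in each of them.  They are
  described by their values, so there may be relations between the monomials; only the number of
  spanning monomials matters below.
\<close>

definition bounded_polys :: "('b \<Rightarrow> 'k::field ratfun) \<Rightarrow> 'b set \<Rightarrow> nat \<Rightarrow> 'k ratfun set" where
  "bounded_polys y H e = ratfun_vs.span ((\<lambda>s. \<Prod>h\<in>H. y h ^ s h) ` (H \<rightarrow>\<^sub>E {..e}))"

lemma bounded_polys_monomial:
  assumes "\<And>h. h \<in> H \<Longrightarrow> s h \<le> e"
  shows "(\<Prod>h\<in>H. y h ^ s h) \<in> bounded_polys y H e"
proof -
  have "(\<Prod>h\<in>H. y h ^ s h) = (\<Prod>h\<in>H. y h ^ restrict s H h)" by (intro prod.cong) auto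
  thus ?thesis unfolding bounded_polys_def
    using assms by (intro ratfun_vs.span_base) (auto intro!: image_eqI[of _ _ "restrict s H"])
qed

lemma bounded_polys_1: "1 \<in> bounded_polys y H e"
  using bounded_polys_monomial[of H "\<lambda>_. 0"] by simp

lemma bounded_polys_add:
  "u \<in> bounded_polys y H e \<Longrightarrow> w \<in> bounded_polys y H e \<Longrightarrow> u + w \<in> bounded_polys y H e"
  unfolding bounded_polys_def by (rule ratfun_vs.span_add)

text \<open>
  Multiplication is bilinear, so the claim passes from monomials to their spans, one factor at a
  time.
\<close>

lemma bounded_polys_mult:
  assumes "u \<in> bounded_polys y H e" "w \<in> bounded_polys y H f"
  shows "u * w \<in> bounded_polys y H (e + f)"
proof -
  have subspace: "ratfun_vs.subspace {u. u * w \<in> bounded_polys y H d}" for w d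
    unfolding bounded_polys_def
    by (rule ratfun_vs.subspaceI)
      (auto simp: ratfun_vs.span_zero distrib_right mult.assoc intro: ratfun_vs.span_add ratfun_vs.span_scale)
  have mono: "u * w \<in> bounded_polys y H (e + f)"
    if u: "u \<in> (\<lambda>s. \<Prod>h\<in>H. y h ^ s h) ` (H \<rightarrow>\<^sub>E {..e})"
      and w: "w \<in> (\<lambda>s. \<Prod>h\<in>H. y h ^ s h) ` (H \<rightarrow>\<^sub>E {..f})" for u w
  proof -
    obtain s where s: "u = (\<Prod>h\<in>H. y h ^ s h)" "s \<in> H \<rightarrow>\<^sub>E {..e}" using u by blast
    obtain t where t: "w = (\<Prod>h\<in>H. y h ^ t h)" "t \<in> H \<rightarrow>\<^sub>E {..f}" using w by blast
    have "s h + t h \<le> e + f" if "h \<in> H" for h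
      using PiE_mem[OF s(2) that] PiE_mem[OF t(2) that] by simp
    moreover have "u * w = (\<Prod>h\<in>H. y h ^ (s h + t h))"
      by (simp add: s(1) t(1) power_add prod.distrib)
    ultimately show ?thesis by (simp add: bounded_polys_monomial)
  qed
  have "w * u \<in> bounded_polys y H (e + f)"
    if w: "w \<in> (\<lambda>s. \<Prod>h\<in>H. y h ^ s h) ` (H \<rightarrow>\<^sub>E {..f})" for w
  proof -
    have "(\<lambda>s. \<Prod>h\<in>H. y h ^ s h) ` (H \<rightarrow>\<^sub>E {..e}) \<subseteq> {v. v * w \<in> bounded_polys y H (e + f)}"
      using mono[OF _ w] by blast
    from subsetD[OF ratfun_vs.span_minimal[OF this subspace]] assms(1)
    have "u * w \<in> bounded_polys y H (e + f)" by (simp add: bounded_polys_def[of _ _ e])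
    thus ?thesis by (subst mult.commute)
  qed
  hence "(\<lambda>s. \<Prod>h\<in>H. y h ^ s h) ` (H \<rightarrow>\<^sub>E {..f}) \<subseteq> {v. v * u \<in> bounded_polys y H (e + f)}"
    by blast
  from subsetD[OF ratfun_vs.span_minimal[OF this subspace]] assms(2)
  have "w * u \<in> bounded_polys y H (e + f)" by (simp add: bounded_polys_def[of _ _ f])
  thus ?thesis by (subst mult.commute)
qed

lemma bounded_polys_power: "u \<in> bounded_polys y H e \<Longrightarrow> u ^ j \<in> bounded_polys y H (j * e)"
  by (induction j) (simp_all add: bounded_polys_1 bounded_polys_mult)

lemma bounded_polys_prod:
  assumes "finite A" "\<And>a. a \<in> A \<Longrightarrow> u a \<in> bounded_polys y H e"
  shows "prod u A \<in> bounded_polys y H (card A * e)"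
  using assms by (induction A rule: finite_induct) (simp_all add: bounded_polys_1 bounded_polys_mult)

text \<open>
  The subfield generated by the constants and the elements \<open>y h\<close>.
\<close>

definition gen_field :: "('b \<Rightarrow> 'k::field ratfun) \<Rightarrow> 'b set \<Rightarrow> 'k ratfun set" where
  "gen_field y H = {u / w | u w e. u \<in> bounded_polys y H e \<and> w \<in> bounded_polys y H e \<and> w \<noteq> 0}"

lemma gen_fieldI:
  "u \<in> bounded_polys y H e \<Longrightarrow> w \<in> bounded_polys y H e \<Longrightarrow> w \<noteq> 0 \<Longrightarrow> u / w \<in> gen_field y H"
  unfolding gen_field_def by blast

lemma gen_fieldI1: "u \<in> bounded_polys y H e \<Longrightarrow> u \<in> gen_field y H"
  using gen_fieldI[OF _ bounded_polys_1] by simp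

lemma is_subfield_gen_field: "is_subfield (gen_field y H)"
  unfolding is_subfield_def
proof (intro conjI ballI)
  show "0 \<in> gen_field y H"
    by (rule gen_fieldI1[of _ _ _ 0]) (simp add: bounded_polys_def ratfun_vs.span_zero)
  show "1 \<in> gen_field y H" by (rule gen_fieldI1[OF bounded_polys_1])
next
  fix a b assume "a \<in> gen_field y H" "b \<in> gen_field y H"
  then obtain u w e u' w' e' where ab: "a = u / w" "w \<noteq> 0" "b = u' / w'" "w' \<noteq> 0"
    and p: "u \<in> bounded_polys y H e" "w \<in> bounded_polys y H e"
      "u' \<in> bounded_polys y H e'" "w' \<in> bounded_polys y H e'"
    unfolding gen_field_def by blast
  have "a + b = (u * w' + w * u') / (w * w')" "a * b = (u * u') / (w * w')"
    using ab by (simp_all add: add_frac_eq mult.commute)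
  thus "a + b \<in> gen_field y H" "a * b \<in> gen_field y H"
    using p ab by (auto intro!: gen_fieldI[of _ _ _ "e + e'"] bounded_polys_add bounded_polys_mult)
next
  fix a assume "a \<in> gen_field y H"
  then obtain u w e where a: "a = u / w" "w \<noteq> 0"
    and p: "u \<in> bounded_polys y H e" "w \<in> bounded_polys y H e"
    unfolding gen_field_def by blast
  have "- u \<in> bounded_polys y H e"
    using p(1) unfolding bounded_polys_def by (rule ratfun_vs.span_neg)
  thus "- a \<in> gen_field y H" using p a gen_fieldI[of "- u" y H e w] by simp
  show "inverse a \<in> gen_field y H"
  proof (cases "u = 0")
    case True
    thus ?thesis using a gen_fieldI[OF p] by simp
  next
    case False
    thus ?thesis using a gen_fieldI[OF p(2,1)] by simp
  qed
qed

lemma const_field_subset_gen_field: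
  fixes y :: "'b \<Rightarrow> 'k::field ratfun"
  shows "const_field \<subseteq> gen_field y H"
proof
  fix a :: "'k ratfun" assume "a \<in> const_field"
  then obtain c where "a = ratfun_const c * 1" by (auto simp: const_field_def)
  moreover have "ratfun_const c * 1 \<in> bounded_polys y H 0"
    using bounded_polys_1 unfolding bounded_polys_def by (rule ratfun_vs.span_scale)
  ultimately show "a \<in> gen_field y H" using gen_fieldI1 by blast
qed

lemma generator_in_gen_field:
  assumes "finite H" "h \<in> H"
  shows "y h \<in> gen_field y H"
proof -
  have "(\<Prod>g\<in>H. y g ^ (if g = h then 1 else 0)) = (\<Prod>g\<in>H. if g = h then y g else 1)"
    by (intro prod.cong) auto
  also have "\<dots> = y h" using assms by simp
  finally show ?thesis
    using bounded_polys_monomial[of H "\<lambda>g. if g = h then 1 else 0" 1 y] gen_fieldI1[of "y h" y H 1]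
    by simp
qed

lemma gen_field_subset_ratfun_field:
  fixes y :: "'b \<Rightarrow> 'k::field ratfun"
  assumes "finite H" "\<And>h. h \<in> H \<Longrightarrow> y h \<in> ratfun_field n"
  shows "gen_field y H \<subseteq> ratfun_field n"
proof -
  have F: "is_subfield (ratfun_field n :: 'k ratfun set)" by (rule is_subfield_ratfun_field)
  have "ratfun_const c \<in> ratfun_field n" for c :: 'k
    using const_field_subset[of n] by (auto simp: const_field_def)
  hence "ratfun_vs.subspace (ratfun_field n :: 'k ratfun set)"
    using F by (intro ratfun_vs.subspaceI) (simp_all add: is_subfield_def)
  moreover have "(\<lambda>s. \<Prod>h\<in>H. y h ^ s h) ` (H \<rightarrow>\<^sub>E {..e}) \<subseteq> ratfun_field n" for e
    using assms by (auto intro!: is_subfield_prod[OF F] is_subfield_power[OF F])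
  ultimately have "bounded_polys y H e \<subseteq> ratfun_field n" for e
    unfolding bounded_polys_def by (intro ratfun_vs.span_minimal)
  moreover have "u / w \<in> ratfun_field n" if "u \<in> ratfun_field n" "w \<in> ratfun_field n"
    for u w :: "'k ratfun"
    using that F unfolding divide_inverse is_subfield_def by blast
  ultimately show ?thesis unfolding gen_field_def by blast
qed

lemma gen_field_common_denominator:
  assumes "finite S" "S \<subseteq> gen_field y H"
  shows "\<exists>g e. g \<noteq> 0 \<and> g \<in> bounded_polys y H e \<and> (\<forall>s\<in>S. g * s \<in> bounded_polys y H e)"
  using assms
proof (induction S rule: finite_induct)
  case empty
  thus ?case using bounded_polys_1 by (intro exI[of _ 1]) auto
next
  case (insert s S)
  then obtain g e where g: "g \<noteq> 0" "g \<in> bounded_polys y H e" "\<forall>t\<in>S. g * t \<in> bounded_polys y H e"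
    by auto
  obtain u w f where s: "s = u / w" "w \<noteq> 0" "u \<in> bounded_polys y H f" "w \<in> bounded_polys y H f"
    using insert.prems by (auto simp: gen_field_def)
  have "(g * w) * t \<in> bounded_polys y H (e + f)" if "t \<in> insert s S" for t
  proof (cases "t = s")
    case True
    thus ?thesis using bounded_polys_mult[OF g(2) s(3)] s by simp
  next
    case False
    hence "(g * t) * w \<in> bounded_polys y H (e + f)" using bounded_polys_mult[OF _ s(4)] g that by auto
    thus ?thesis by (simp add: mult_ac)
  qed
  thus ?case using g s bounded_polys_mult[OF g(2) s(4)] by (intro exI[of _ "g * w"] exI[of _ "e + f"]) simp
qed

text \<open>
  A counting argument.  Write \<open>N\<close> for the number of generators, and let \<open>g\<close> be a common denominator
  of more than \<open>N\<close> elements of the field.  The monomials in these elements with all exponents at most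
  \<open>D\<close> number at least \<open>(D + 1) ^ (N + 1)\<close>.  Multiplied by a suitable power of \<open>g\<close>, they all lie in
  the span of \<open>O(D ^ N)\<close> monomials in the generators.  For large \<open>D\<close> they are therefore linearly
  dependent, which is an algebraic relation.
\<close>

lemma trdeg_gen_field_le:
  fixes y :: "'b \<Rightarrow> 'k::field ratfun"
  assumes "finite H"
  shows "trdeg const_field (gen_field y H) \<le> enat (card H)"
  unfolding trdeg_def
proof (rule SUP_least, clarify)
  fix S assume S: "S \<subseteq> gen_field y H" "finite S" and ind: "alg_independent const_field S"
  have "card S \<le> card H"
  proof (rule ccontr)
    assume "\<not> card S \<le> card H"
    hence gt: "card H + 1 \<le> card S" by simp
    obtain g e where g: "g \<noteq> 0" "g \<in> bounded_polys y H e" "\<And>s. s \<in> S \<Longrightarrow> g * s \<in> bounded_polys y H e"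
      using gen_field_common_denominator[OF S(2,1)] by blast
    \<comment> \<open>\<open>c\<close> and \<open>D\<close> are chosen for \<open>(c * (D + 1)) ^ N = D * (D + 1) ^ N < (D + 1) ^ (N + 1)\<close>,
      where \<open>N = card H\<close>\<close>
    define c where "c = card S * e + 1"
    define D where "D = c ^ card H"
    define T where "T = S \<rightarrow>\<^sub>E {..D}"
    define B where "B = (\<lambda>s. \<Prod>h\<in>H. y h ^ s h) ` (H \<rightarrow>\<^sub>E {..card S * (D * e)})"
    \<comment> \<open>each exponent is at most \<open>D\<close>, so \<open>g ^ D\<close> per factor clears the denominators\<close>
    define F where "F \<phi> = g ^ (card S * D) * (\<Prod>s\<in>S. s ^ \<phi> s)" for \<phi>
    have fin: "finite T" "finite B"
      using S(2) assms by (auto simp: T_def B_def intro!: finite_PiE)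
    have "card B \<le> card (H \<rightarrow>\<^sub>E {..card S * (D * e)})"
      unfolding B_def using assms by (intro card_image_le finite_PiE) auto
    also have "\<dots> = (card S * (D * e) + 1) ^ card H" using assms by (simp add: card_funcsetE)
    also have "\<dots> \<le> (c * (D + 1)) ^ card H"
      unfolding c_def by (intro power_mono) (auto simp: algebra_simps)
    also have "\<dots> = D * (D + 1) ^ card H" unfolding D_def by (rule power_mult_distrib)
    also have "\<dots> < (D + 1) ^ (card H + 1)" by simp
    also have "\<dots> \<le> (D + 1) ^ card S" using gt by (intro power_increasing) auto
    also have "\<dots> = card T" using S(2) by (simp add: T_def card_funcsetE)
    finally have card: "card B < card T" .
    have "F \<phi> \<in> ratfun_vs.span B" if \<phi>: "\<phi> \<in> T" for \<phi>
    proof -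
      have le: "\<phi> s \<le> D" if "s \<in> S" for s using \<phi> that by (auto simp: T_def)
      have "F \<phi> = (\<Prod>s\<in>S. g ^ D * s ^ \<phi> s)"
        by (simp add: F_def prod.distrib power_mult[symmetric] mult.commute)
      also have "\<dots> = (\<Prod>s\<in>S. (g * s) ^ \<phi> s * g ^ (D - \<phi> s))"
      proof (intro prod.cong refl)
        fix s assume "s \<in> S"
        hence "g ^ D = g ^ \<phi> s * g ^ (D - \<phi> s)" using le by (simp add: power_add[symmetric])
        thus "g ^ D * s ^ \<phi> s = (g * s) ^ \<phi> s * g ^ (D - \<phi> s)" by (simp add: power_mult_distrib mult_ac)
      qed
      also have "\<dots> \<in> bounded_polys y H (card S * (D * e))"
      proof (intro bounded_polys_prod S(2))
        fix s assume s: "s \<in> S"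
        have "\<phi> s * e + (D - \<phi> s) * e = D * e" using le[OF s] by (simp add: add_mult_distrib[symmetric])
        thus "(g * s) ^ \<phi> s * g ^ (D - \<phi> s) \<in> bounded_polys y H (D * e)"
          using bounded_polys_mult[OF bounded_polys_power[OF g(3)[OF s]] bounded_polys_power[OF g(2)], of "\<phi> s" "D - \<phi> s"]
          by simp
      qed
      finally show ?thesis by (simp add: bounded_polys_def B_def)
    qed
    hence span: "F ` T \<subseteq> ratfun_vs.span B" by blast
    obtain a where a: "\<exists>\<phi>\<in>T. a \<phi> \<noteq> 0" "(\<Sum>\<phi>\<in>T. ratfun_const (a \<phi>) * F \<phi>) = 0"
      by (rule ratfun_vs.linear_relation_if_card_gt[OF fin span card])
    have "g ^ (card S * D) * (\<Sum>\<phi>\<in>T. ratfun_const (a \<phi>) * (\<Prod>s\<in>S. s ^ \<phi> s)) = 0"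
      using a(2) by (simp add: F_def sum_distrib_left mult_ac)
    hence zero: "(\<Sum>\<phi>\<in>T. ratfun_const (a \<phi>) * (\<Prod>s\<in>S. s ^ \<phi> s)) = 0" using g(1) by simp
    have k: "ratfun_const x \<in> const_field" for x :: 'k by (simp add: const_field_def)
    have "ratfun_const (a \<phi>) = 0" if "\<phi> \<in> T" for \<phi>
    proof (rule alg_independentD[OF ind S(2) _ fin(1) _ _ zero that])
      show "0 \<in> (const_field :: 'k ratfun set)" using k[of 0] by (simp add: ratfun_const_0)
      show "T \<subseteq> S \<rightarrow>\<^sub>E UNIV" unfolding T_def by (rule PiE_mono) simp
    qed (rule k)
    thus False using a(1) by (simp add: ratfun_const_eq_0_iff)
  qed
  thus "enat (card S) \<le> enat (card H)" by simp
qed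

section \<open>Integer matrices and elementary divisors\<close>

lemma eq_0_if_all_powers_dvd:
  fixes x d :: int
  assumes "d \<ge> 2" "\<And>k. d ^ k dvd x"
  shows "x = 0"
proof (rule ccontr)
  assume "x \<noteq> 0"
  let ?k = "nat \<bar>x\<bar>"
  have "\<bar>x\<bar> < 2 ^ ?k" using of_nat_less_two_power[of ?k, where ?'a = int] by simp
  also have "2 ^ ?k \<le> d ^ ?k" using assms(1) by (intro power_mono) auto
  also have "d ^ ?k \<le> \<bar>x\<bar>"
    using assms(2)[of ?k] \<open>x \<noteq> 0\<close> by (intro zdvd_imp_le) auto
  finally show False by simp
qed

lemma mat_mult_entry:
  assumes "A \<in> carrier_mat n k" "B \<in> carrier_mat k m" "i < n" "j < m"
  shows "(A * B) $$ (i, j) = (\<Sum>h<k. A $$ (i, h) * B $$ (h, j))"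
  using assms by (auto simp: scalar_prod_def atLeast0LessThan intro!: sum.cong)

text \<open>
  Infinite descent: a relation between the vectors \<open>W i\<close> holds modulo \<open>d\<close> between rows of the
  invertible matrix \<open>P\<close>, so all its coefficients are divisible by \<open>d\<close>.  Dividing by \<open>d\<close> gives
  another such relation, and so the coefficients are divisible by every power of \<open>d\<close>.
\<close>

lemma rows_independent_mod:
  fixes P P' :: "int mat"
  assumes P: "P \<in> carrier_mat n n" "P' \<in> carrier_mat n n" "P * P' = 1\<^sub>m n"
    and I: "I \<subseteq> {..<n}" and d: "d \<ge> 2"
    and W: "\<And>i c. i \<in> I \<Longrightarrow> c < n \<Longrightarrow> W i c = P $$ (i, c) + d * U i c"
    and rel: "\<And>c. c < n \<Longrightarrow> (\<Sum>i\<in>I. z i * W i c) = 0"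
  shows "\<forall>i\<in>I. z i = 0"
proof -
  have fin: "finite I" using I finite_subset by blast
  have "\<forall>i\<in>I. d ^ k dvd z i" if "\<And>c. c < n \<Longrightarrow> (\<Sum>i\<in>I. z i * W i c) = 0" for z k
    using that
  proof (induction k arbitrary: z)
    case 0
    show ?case by simp
  next
    case (Suc k)
    have "d dvd z i" if i: "i \<in> I" for i
    proof -
      have "z i = (\<Sum>j\<in>I. z j * (if j = i then 1 else 0))"
        using fin i by (simp add: if_distrib[of "\<lambda>x. _ * x"] cong: if_cong)
      also have "\<dots> = (\<Sum>j\<in>I. z j * (P * P') $$ (j, i))"
      proof (intro sum.cong refl arg_cong2[where f = "(*)"])
        fix j assume "j \<in> I"
        hence "j < n" "i < n" using I i by auto
        thus "(if j = i then 1 else 0) = (P * P') $$ (j, i)" by (simp add: P(3))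
      qed
      also have "\<dots> = (\<Sum>j\<in>I. z j * (\<Sum>c<n. P $$ (j, c) * P' $$ (c, i)))"
        using I i by (intro sum.cong) (auto simp: mat_mult_entry[OF P(1,2)] subset_iff)
      also have "\<dots> = (\<Sum>c<n. (\<Sum>j\<in>I. z j * P $$ (j, c)) * P' $$ (c, i))"
        by (simp add: sum_distrib_left sum_distrib_right mult_ac) (rule sum.swap)
      also have "\<dots> = (\<Sum>c<n. d * (- (\<Sum>j\<in>I. z j * U j c) * P' $$ (c, i)))"
      proof (intro sum.cong refl)
        fix c assume "c \<in> {..<n}"
        hence c: "c < n" by simp
        have "(\<Sum>j\<in>I. z j * P $$ (j, c)) + d * (\<Sum>j\<in>I. z j * U j c) = (\<Sum>j\<in>I. z j * W j c)"
          using c by (simp add: W distrib_left sum.distrib sum_distrib_left mult_ac)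
        hence "(\<Sum>j\<in>I. z j * P $$ (j, c)) = - (d * (\<Sum>j\<in>I. z j * U j c))"
          using Suc.prems[OF c] by simp
        thus "(\<Sum>j\<in>I. z j * P $$ (j, c)) * P' $$ (c, i) = d * (- (\<Sum>j\<in>I. z j * U j c) * P' $$ (c, i))"
          by simp
      qed
      also have "\<dots> = d * (\<Sum>c<n. - (\<Sum>j\<in>I. z j * U j c) * P' $$ (c, i))"
        by (simp only: sum_distrib_left)
      finally show ?thesis by simp
    qed
    hence z: "z i = d * (z i div d)" if "i \<in> I" for i using that by simp
    have "(\<Sum>i\<in>I. (z i div d) * W i c) = 0" if "c < n" for c
    proof -
      have "d * (\<Sum>i\<in>I. (z i div d) * W i c) = (\<Sum>i\<in>I. (d * (z i div d)) * W i c)"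
        by (simp add: sum_distrib_left mult.assoc)
      also have "\<dots> = (\<Sum>i\<in>I. z i * W i c)"
        using z by (intro sum.cong) auto
      finally have "d * (\<Sum>i\<in>I. (z i div d) * W i c) = 0" using Suc.prems[OF that] by simp
      thus ?thesis using d by simp
    qed
    from Suc.IH[OF this] have "\<forall>i\<in>I. d ^ k dvd z i div d" .
    thus ?case using z by (metis mult_dvd_mono dvd_refl power_Suc)
  qed
  from this[OF rel] show ?thesis using eq_0_if_all_powers_dvd[OF d] by blast
qed

text \<open>
  The divisors equal to \<open>1\<close> come first, since a divisor of \<open>1\<close> is \<open>1\<close>.
\<close>

lemma nth_eq_1_iff_dvd_chain:
  fixes ds :: "int list"
  assumes "sorted_wrt (dvd) ds" "\<forall>d\<in>set ds. d > 0" "i < length ds"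
  shows "ds ! i = 1 \<longleftrightarrow> i < count_list ds 1"
  using assms
proof (induction ds arbitrary: i)
  case (Cons d ds)
  show ?case
  proof (cases "d = 1")
    case True
    thus ?thesis using Cons by (cases i) auto
  next
    case False
    have "e \<noteq> 1" if "e \<in> set ds" for e using that Cons.prems False by auto
    hence "count_list ds 1 = 0" "1 \<notin> set (d # ds)" using False by (auto simp: count_list_0_iff)
    thus ?thesis using False Cons.prems(3) nth_mem[of i "d # ds"] by auto
  qed
qed simp

lemma int_mat_inverse:
  fixes P :: "int mat"
  assumes "P \<in> carrier_mat n n" "invertible_mat P"
  obtains P' where "P' \<in> carrier_mat n n" "P * P' = 1\<^sub>m n" "P' * P = 1\<^sub>m n"
proof -
  obtain P' where P': "P * P' = 1\<^sub>m (dim_row P)" "P' * P = 1\<^sub>m (dim_row P')"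
    using assms(2) by (auto simp: invertible_mat_def inverts_mat_def)
  have "dim_col (P * P') = n" "dim_col (P' * P) = dim_row P'" using assms(1) P' by auto
  hence "P' \<in> carrier_mat n n" using assms(1) by auto
  thus ?thesis using that[of P'] P' assms(1) by auto
qed

section \<open>Points of the generic orbit over small fields\<close>

text \<open>
  Every orbit over \<open>K0\<close> is the orbit of some point \<open>a\<close> with coordinates in \<open>K0\<close>, and its image is
  the orbit of \<open>a\<close> over the big field.  This is the generic orbit iff \<open>a = t \<cdot> x\<close> for some \<open>t\<close>.
\<close>

lemma generic_point_in_image_iff:
  fixes K0 :: "'k::field ratfun set"
  assumes E: "E \<in> carrier_mat n m" and K0: "is_subfield K0" "K0 \<subseteq> ratfun_field n"
  shows "generic_point E \<in> orbit_map E K0 (ratfun_field n) ` orbit_functor E K0 \<longleftrightarrow>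
    (\<exists>t\<in>torus m (ratfun_field n). torus_act E t (vec n ratfun_var) \<in> coord_space n K0)"
proof -
  let ?K = "ratfun_field n :: 'k ratfun set"
  let ?x = "vec n ratfun_var :: 'k ratfun vec"
  have dim: "dim_row E = n" "dim_col E = m" using E by auto
  have equiv: "equiv (coord_space (dim_row E) ?K) (orbit_rel E ?K)"
    by (rule equiv_orbit_rel[OF is_subfield_ratfun_field])
  have x: "?x \<in> coord_space n ?K" by (auto simp: coord_space_def ratfun_var_in)
  have image: "orbit_map E K0 ?K (orbit_rel E K0 `` {a}) = orbit_rel E ?K `` {a}"
    if "a \<in> coord_space n K0" for a
    using orbit_map_orbit[OF K0(1) is_subfield_ratfun_field K0(2), of a E] that dim by simp
  have orbit_eq: "orbit_rel E ?K `` {?x} = orbit_rel E ?K `` {a} \<longleftrightarrow> (?x, a) \<in> orbit_rel E ?K"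
    if "a \<in> coord_space n K0" for a
  proof -
    have "a \<in> coord_space n ?K" using that K0(2) by (auto simp: coord_space_def)
    thus ?thesis using eq_equiv_class_iff[OF equiv] x dim by simp
  qed
  have "generic_point E \<in> orbit_map E K0 ?K ` orbit_functor E K0 \<longleftrightarrow>
    (\<exists>a\<in>coord_space n K0. orbit_rel E ?K `` {?x} = orbit_rel E ?K `` {a})"
    unfolding generic_point_def orbit_functor_def quotient_def dim using image by auto
  also have "\<dots> \<longleftrightarrow> (\<exists>a\<in>coord_space n K0. (?x, a) \<in> orbit_rel E ?K)"
    using orbit_eq by blast
  also have "\<dots> \<longleftrightarrow> (\<exists>t\<in>torus m ?K. torus_act E t ?x \<in> coord_space n K0)"
    unfolding orbit_rel_def dim using x by auto
  finally show ?thesis .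
qed

text \<open>
  The lower bound.  Let \<open>a = t \<cdot> x\<close> have coordinates in \<open>K0\<close>, and put \<open>b\<^sub>i = \<Prod>\<^sub>j a\<^sub>j ^ P\<^sub>i\<^sub>j\<close>.
  The degree of \<open>b\<^sub>i\<close> is the \<open>i\<close>-th row of \<open>P\<close> plus an integer combination of the degrees of the
  \<open>t\<^sub>h\<close> with coefficients from the \<open>i\<close>-th row of \<open>P * E\<close>.  For \<open>i \<ge> l\<close> these are divisible by \<open>d\<close>:
  the unknown torus element cannot change the degrees modulo \<open>d\<close>, so they stay linearly
  independent and the \<open>b\<^sub>i\<close> are algebraically independent.
\<close>

lemma trdeg_ge_if_orbit_meets:
  fixes E P P' :: "int mat" and K0 :: "'k::field ratfun set"
  assumes E: "E \<in> carrier_mat n m"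
    and P: "P \<in> carrier_mat n n" "P' \<in> carrier_mat n n" "P * P' = 1\<^sub>m n"
    and d: "d \<ge> 2" "\<And>i h. l \<le> i \<Longrightarrow> i < n \<Longrightarrow> h < m \<Longrightarrow> d dvd (P * E) $$ (i, h)"
    and K0: "is_subfield K0"
    and t: "t \<in> torus m (ratfun_field n)"
    and meet: "torus_act E t (vec n ratfun_var) \<in> coord_space n K0"
  shows "enat (n - l) \<le> trdeg const_field K0"
proof -
  define a where "a = torus_act E t (vec n ratfun_var)"
  have dim: "dim_row E = n" "dim_col E = m" using E by auto
  have t0: "t $ h \<noteq> 0" if "h < m" for h using t that by (auto simp: torus_def coord_space_def)
  have a: "a $ j = ratfun_var j * (\<Prod>h<m. (t $ h) powi (E $$ (j, h)))" if "j < n" for j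
    using that by (simp add: a_def torus_act_def dim)
  have a0: "a $ j \<noteq> 0" if "j < n" for j
    using a[OF that] ratfun_var_neq_0 t0 by (simp add: power_int_not_zero)
  have deg_a: "ratfun_deg (a $ j) c = (if j = c then 1 else 0) + (\<Sum>h<m. E $$ (j, h) * ratfun_deg (t $ h) c)"
    if "j < n" for j c
  proof -
    have "ratfun_deg (\<Prod>h<m. (t $ h) powi (E $$ (j, h))) c
        = (\<Sum>h<m. ratfun_deg ((t $ h) powi (E $$ (j, h))) c)"
      using t0 by (intro ratfun_deg_prod) auto
    also have "\<dots> = (\<Sum>h<m. E $$ (j, h) * ratfun_deg (t $ h) c)"
      using t0 by (intro sum.cong) (auto simp: ratfun_deg_powi)
    finally show ?thesis
      unfolding a[OF that] using ratfun_var_neq_0 t0 by (subst ratfun_deg_mult) (auto simp: ratfun_deg_var)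
  qed
  define b where "b i = (\<Prod>j<n. (a $ j) powi (P $$ (i, j)))" for i
  have b0: "b i \<noteq> 0" for i using a0 by (simp add: b_def power_int_not_zero)
  have deg_b: "ratfun_deg (b i) c = P $$ (i, c) + (\<Sum>h<m. (P * E) $$ (i, h) * ratfun_deg (t $ h) c)"
    if i: "i < n" and c: "c < n" for i c
  proof -
    have "ratfun_deg (b i) c = (\<Sum>j<n. ratfun_deg ((a $ j) powi (P $$ (i, j))) c)"
      unfolding b_def using a0 by (intro ratfun_deg_prod) auto
    also have "\<dots> = (\<Sum>j<n. P $$ (i, j) * ratfun_deg (a $ j) c)"
      using a0 by (intro sum.cong) (auto simp: ratfun_deg_powi)
    also have "\<dots> = (\<Sum>j<n. P $$ (i, j) * (if j = c then 1 else 0))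
        + (\<Sum>j<n. \<Sum>h<m. P $$ (i, j) * E $$ (j, h) * ratfun_deg (t $ h) c)"
      by (simp add: deg_a distrib_left sum.distrib sum_distrib_left mult.assoc)
    also have "(\<Sum>j<n. P $$ (i, j) * (if j = c then 1 else 0)) = P $$ (i, c)"
      using c by (simp add: if_distrib[of "\<lambda>x. _ * x"] cong: if_cong)
    also have "(\<Sum>j<n. \<Sum>h<m. P $$ (i, j) * E $$ (j, h) * ratfun_deg (t $ h) c)
        = (\<Sum>h<m. (P * E) $$ (i, h) * ratfun_deg (t $ h) c)"
      using i by (subst sum.swap) (simp add: mat_mult_entry[OF P(1) E] sum_distrib_right)
    finally show ?thesis .
  qed
  have indep: "\<forall>i\<in>{l..<n}. z i = 0"
    if rel: "\<And>c. (\<Sum>i\<in>{l..<n}. z i * ratfun_deg (b i) c) = 0" for z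
  proof (rule rows_independent_mod[OF P _ d(1) _ rel])
    fix i c assume ic: "i \<in> {l..<n}" "c < n"
    have "(\<Sum>h<m. (P * E) $$ (i, h) * ratfun_deg (t $ h) c)
        = d * (\<Sum>h<m. ((P * E) $$ (i, h) div d) * ratfun_deg (t $ h) c)"
      using ic d(2)[of i] by (simp add: sum_distrib_left mult.assoc[symmetric])
    thus "ratfun_deg (b i) c = P $$ (i, c) + d * (\<Sum>h<m. ((P * E) $$ (i, h) div d) * ratfun_deg (t $ h) c)"
      using deg_b ic by simp
  qed auto
  have "b i \<in> K0" for i
    unfolding b_def using meet K0
    by (intro is_subfield_prod is_subfield_powi) (auto simp: coord_space_def a_def)
  hence "b ` {l..<n} \<subseteq> K0" by blast
  moreover have "inj_on b {l..<n}" "alg_independent const_field (b ` {l..<n})"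
    using alg_independent_family[of "{l..<n}" b] b0 indep by simp_all
  ultimately have "enat (card {l..<n}) \<le> trdeg const_field K0"
    by (intro trdeg_ge_family[of _ b]) auto
  thus ?thesis by simp
qed

definition laurent_monomial :: "nat \<Rightarrow> (nat \<Rightarrow> int) \<Rightarrow> 'k::field ratfun" where
  "laurent_monomial n w = (\<Prod>c<n. ratfun_var c powi w c)"

lemma laurent_monomial_neq_0: "laurent_monomial n w \<noteq> (0 :: 'k::field ratfun)"
  by (simp add: laurent_monomial_def power_int_not_zero ratfun_var_neq_0)

lemma laurent_monomial_in_ratfun_field: "laurent_monomial n w \<in> ratfun_field n"
  unfolding laurent_monomial_def
  by (intro is_subfield_prod is_subfield_powi is_subfield_ratfun_field) (auto simp: ratfun_var_in)

lemma laurent_monomial_add: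
  "laurent_monomial n (\<lambda>c. v c + w c) = laurent_monomial n v * (laurent_monomial n w :: 'k::field ratfun)"
  by (simp add: laurent_monomial_def power_int_add ratfun_var_neq_0 prod.distrib)

lemma laurent_monomial_powi:
  "laurent_monomial n (\<lambda>c. e * w c) = (laurent_monomial n w powi e :: 'k::field ratfun)"
  unfolding laurent_monomial_def
  by (induction n) (simp_all add: power_int_mult_distrib power_int_mult[symmetric] mult.commute)

lemma laurent_monomial_sum:
  "laurent_monomial n (\<lambda>c. \<Sum>h\<in>A. e h * w h c)
    = (\<Prod>h\<in>A. laurent_monomial n (w h) powi e h :: 'k::field ratfun)"
proof (induction A rule: infinite_finite_induct)
  case (insert h A)
  thus ?case by (simp add: laurent_monomial_add laurent_monomial_powi)
qed (simp_all add: laurent_monomial_def)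

lemma laurent_monomial_unit:
  "i < n \<Longrightarrow> laurent_monomial n (\<lambda>c. if i = c then 1 else 0) = (ratfun_var i :: 'k::field ratfun)"
  unfolding laurent_monomial_def by (subst prod.remove[of _ i]) (auto intro!: prod.neutral)

lemma laurent_monomial_cong:
  "(\<And>c. c < n \<Longrightarrow> v c = w c) \<Longrightarrow> laurent_monomial n v = laurent_monomial n w"
  by (simp add: laurent_monomial_def)

text \<open>
  The upper bound.  In the coordinates \<open>y\<^sub>h = x ^ (row h of P)\<close> and \<open>\<mu>\<close> with \<open>t = \<mu> ^ Q\<close>, a
  unit divisor lets \<open>\<mu>\<^sub>h\<close> act on \<open>y\<^sub>h\<close> by plain multiplication, so that \<open>\<mu>\<^sub>h = 1 / y\<^sub>h\<close> moves it
  to \<open>1\<close>.  Doing this for all \<open>h < l\<close> (with \<open>\<mu>\<^sub>h = 1\<close> for the others) leaves \<open>y\<^sub>l, \<dots>, y\<^sub>n\<^sub>-\<^sub>1\<close>,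
  and transforming back by \<open>P' = P\<^sup>-\<^sup>1\<close> gives a point of the orbit whose coordinates are Laurent
  monomials in these \<open>n - l\<close> elements.  The hypothesis on \<open>E * Q\<close> expresses that the first \<open>l\<close>
  columns of the Smith form \<open>P * E * Q\<close> are unit vectors.
\<close>

lemma orbit_meets_small_field:
  fixes E P P' Q :: "int mat"
  assumes E: "E \<in> carrier_mat n m"
    and P: "P \<in> carrier_mat n n" "P' \<in> carrier_mat n n" "P' * P = 1\<^sub>m n"
    and Q: "Q \<in> carrier_mat m m" and l: "l \<le> n" "l \<le> m"
    and EQ: "\<And>i h. i < n \<Longrightarrow> h < l \<Longrightarrow> (E * Q) $$ (i, h) = P' $$ (i, h)"
  shows "\<exists>K0 :: 'k::field ratfun set. is_subfield K0 \<and> const_field \<subseteq> K0 \<and> K0 \<subseteq> ratfun_field n \<and>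
    trdeg const_field K0 \<le> enat (n - l) \<and>
    (\<exists>t\<in>torus m (ratfun_field n). torus_act E t (vec n ratfun_var) \<in> coord_space n K0)"
proof -
  define y :: "nat \<Rightarrow> 'k ratfun" where "y h = laurent_monomial n (\<lambda>c. P $$ (h, c))" for h
  \<comment> \<open>the exponents of \<open>t = \<mu> ^ Q\<close> in the variables\<close>
  define R where "R j c = (\<Sum>h<l. Q $$ (j, h) * - P $$ (h, c))" for j c
  define t :: "'k ratfun vec" where "t = vec m (\<lambda>j. laurent_monomial n (R j))"
  let ?K0 = "gen_field y {l..<n}"
  have dim: "dim_row E = n" "dim_col E = m" using E by auto
  have y_in: "y h \<in> ratfun_field n" for h unfolding y_def by (rule laurent_monomial_in_ratfun_field)
  have t: "t \<in> torus m (ratfun_field n)"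
    by (simp add: t_def torus_def coord_space_def laurent_monomial_in_ratfun_field laurent_monomial_neq_0)
  have "torus_act E t (vec n ratfun_var) $ i \<in> ?K0" if i: "i < n" for i
  proof -
    have exps: "(if i = c then 1 else 0) + (\<Sum>j<m. E $$ (i, j) * R j c)
        = (\<Sum>h\<in>{l..<n}. P' $$ (i, h) * P $$ (h, c))" if c: "c < n" for c
    proof -
      have "(\<Sum>j<m. E $$ (i, j) * R j c) = (\<Sum>h<l. (\<Sum>j<m. E $$ (i, j) * Q $$ (j, h)) * - P $$ (h, c))"
        unfolding R_def sum_distrib_left sum_distrib_right by (subst sum.swap) (simp add: mult.assoc)
      also have "\<dots> = (\<Sum>h<l. P' $$ (i, h) * - P $$ (h, c))"
      proof (intro sum.cong refl)
        fix h assume "h \<in> {..<l}"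
        hence "(\<Sum>j<m. E $$ (i, j) * Q $$ (j, h)) = P' $$ (i, h)"
          using EQ[OF i, of h] mat_mult_entry[OF E Q i, of h] l by simp
        thus "(\<Sum>j<m. E $$ (i, j) * Q $$ (j, h)) * - P $$ (h, c) = P' $$ (i, h) * - P $$ (h, c)" by simp
      qed
      also have "\<dots> = - (\<Sum>h<l. P' $$ (i, h) * P $$ (h, c))" by (simp add: sum_negf)
      finally have *: "(\<Sum>j<m. E $$ (i, j) * R j c) = - (\<Sum>h<l. P' $$ (i, h) * P $$ (h, c))" .
      have "(if i = c then 1 else 0) = (P' * P) $$ (i, c)" using i c by (simp add: P(3))
      also have "\<dots> = (\<Sum>h<n. P' $$ (i, h) * P $$ (h, c))" by (rule mat_mult_entry[OF P(2,1) i c])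
      also have "{..<n} = {..<l} \<union> {l..<n}" using l by auto
      also have "(\<Sum>h\<in>{..<l} \<union> {l..<n}. P' $$ (i, h) * P $$ (h, c))
          = (\<Sum>h<l. P' $$ (i, h) * P $$ (h, c)) + (\<Sum>h\<in>{l..<n}. P' $$ (i, h) * P $$ (h, c))"
        by (intro sum.union_disjoint) auto
      finally show ?thesis using * by simp
    qed
    have "torus_act E t (vec n ratfun_var) $ i
        = ratfun_var i * (\<Prod>j<m. laurent_monomial n (R j) powi (E $$ (i, j)))"
      using i by (simp add: torus_act_def dim t_def)
    also have "\<dots> = laurent_monomial n (\<lambda>c. (if i = c then 1 else 0) + (\<Sum>j<m. E $$ (i, j) * R j c))"
      using i by (simp add: laurent_monomial_add laurent_monomial_unit laurent_monomial_sum)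
    also have "\<dots> = laurent_monomial n (\<lambda>c. \<Sum>h\<in>{l..<n}. P' $$ (i, h) * P $$ (h, c))"
      by (rule laurent_monomial_cong) (rule exps)
    also have "\<dots> = (\<Prod>h\<in>{l..<n}. y h powi (P' $$ (i, h)))"
      unfolding y_def by (rule laurent_monomial_sum)
    also have "\<dots> \<in> ?K0"
      by (intro is_subfield_prod is_subfield_powi is_subfield_gen_field generator_in_gen_field) auto
    finally show ?thesis .
  qed
  moreover have "torus_act E t (vec n ratfun_var) \<in> carrier_vec n" by (simp add: torus_act_def dim)
  ultimately have "torus_act E t (vec n ratfun_var) \<in> coord_space n ?K0"
    unfolding coord_space_def by blast
  moreover have "trdeg const_field ?K0 \<le> enat (n - l)" using trdeg_gen_field_le[of "{l..<n}" y] by simp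
  moreover have "?K0 \<subseteq> ratfun_field n" using y_in by (intro gen_field_subset_ratfun_field) auto
  ultimately show ?thesis using is_subfield_gen_field const_field_subset_gen_field t by blast
qed

section \<open>The essential dimension of the generic point\<close>

theorem theorem4p1:
  fixes E :: "int mat" and n m :: nat and ds :: "int list"
  assumes "n \<ge> 1" and "m \<ge> 1"
    and "E \<in> carrier_mat n m"
    and "elementary_divisors E ds"
  shows "essential_dim (const_field :: 'k::{alg_closed_field, field_char_0} ratfun set)
           (orbit_functor E) (orbit_map E) (ratfun_field n) (generic_point E)
         = enat (n - count_list ds 1)"
proof -
  note E = assms(3)
  have dim: "dim_row E = n" "dim_col E = m" using E by auto
  define l where "l = count_list ds 1"
  define D where "D = smith_diag n m ds"
  have ds: "length ds \<le> n" "length ds \<le> m" "\<forall>d\<in>set ds. d > 0" "sorted_wrt (dvd) ds"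
    using assms(4) by (auto simp: elementary_divisors_def dim)
  obtain P Q where P: "P \<in> carrier_mat n n" "invertible_mat P"
    and Q: "Q \<in> carrier_mat m m" "invertible_mat Q" and PEQ: "P * E * Q = D"
    using assms(4) by (auto simp: elementary_divisors_def dim D_def)
  obtain P' where P': "P' \<in> carrier_mat n n" "P * P' = 1\<^sub>m n" "P' * P = 1\<^sub>m n"
    using int_mat_inverse[OF P] .
  obtain Q' where Q': "Q' \<in> carrier_mat m m" "Q * Q' = 1\<^sub>m m" "Q' * Q = 1\<^sub>m m"
    using int_mat_inverse[OF Q] .
  have D: "D \<in> carrier_mat n m" by (simp add: D_def smith_diag_def)
  have D_entry: "D $$ (i, h) = (if i = h \<and> i < length ds then ds ! i else 0)" if "i < n" "h < m" for i h
    using that by (simp add: D_def smith_diag_def)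
  have l: "l \<le> length ds" unfolding l_def by (rule count_le_length)
  have one_iff: "ds ! i = 1 \<longleftrightarrow> i < l" if "i < length ds" for i
    unfolding l_def using nth_eq_1_iff_dvd_chain[OF ds(4,3) that] .

  \<comment> \<open>\<open>d\<close> has to divide all diagonal entries from position \<open>l\<close> on, which the first divisor other
    than \<open>1\<close> does; if there is none, these entries are \<open>0\<close> and any integer greater than \<open>1\<close> will do\<close>
  define d where "d = (if l < length ds then ds ! l else 2)"
  have d2: "d \<ge> 2"
  proof (cases "l < length ds")
    case True
    hence "ds ! l > 0" "ds ! l \<noteq> 1" using ds(3) one_iff by auto
    thus ?thesis using True by (simp add: d_def)
  qed (simp add: d_def)
  have d_dvd: "d dvd D $$ (i, h)" if "l \<le> i" "i < n" "h < m" for i h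
  proof (cases "i = h \<and> i < length ds")
    case True
    hence "ds ! l dvd ds ! i"
      using sorted_wrt_nth_less[OF ds(4), of l i] that by (cases "l = i") auto
    thus ?thesis using True that by (simp add: D_entry d_def)
  next
    case False
    thus ?thesis using that by (auto simp: D_entry)
  qed

  have cPE: "P * E \<in> carrier_mat n m" and cEQ: "E * Q \<in> carrier_mat n m" using P E Q by auto
  have "P * E = P * E * (Q * Q')" unfolding Q'(2) by (rule right_mult_one_mat[OF cPE, symmetric])
  also have "\<dots> = P * E * Q * Q'" by (rule assoc_mult_mat[OF cPE Q(1) Q'(1), symmetric])
  also have "\<dots> = D * Q'" by (simp only: PEQ)
  finally have "P * E = D * Q'" .
  hence PE: "d dvd (P * E) $$ (i, h)" if "l \<le> i" "i < n" "h < m" for i h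
    using that d_dvd unfolding \<open>P * E = D * Q'\<close>
    by (auto simp: mat_mult_entry[OF D Q'(1)] intro!: dvd_sum dvd_mult2)

  have "E * Q = P' * P * (E * Q)" unfolding P'(3) by (rule left_mult_one_mat[OF cEQ, symmetric])
  also have "\<dots> = P' * (P * (E * Q))" by (rule assoc_mult_mat[OF P'(1) P(1) cEQ])
  also have "P * (E * Q) = D" unfolding PEQ[symmetric] by (rule assoc_mult_mat[OF P(1) E Q(1), symmetric])
  finally have EQ': "E * Q = P' * D" .
  have EQ: "(E * Q) $$ (i, h) = P' $$ (i, h)" if ih: "i < n" "h < l" for i h
  proof -
    have h: "h < n" "h < m" using ih l ds by auto
    have "(E * Q) $$ (i, h) = (\<Sum>g<n. P' $$ (i, g) * D $$ (g, h))"
      unfolding EQ' by (rule mat_mult_entry[OF P'(1) D ih(1) h(2)])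
    also have "\<dots> = (\<Sum>g<n. if g = h then P' $$ (i, g) else 0)"
      using ih l h one_iff by (intro sum.cong) (auto simp: D_entry)
    also have "\<dots> = P' $$ (i, h)" using h by simp
    finally show ?thesis .
  qed

  let ?admissible = "\<lambda>K0 :: 'k ratfun set. is_subfield K0 \<and> const_field \<subseteq> K0 \<and> K0 \<subseteq> ratfun_field n \<and>
    generic_point E \<in> orbit_map E K0 (ratfun_field n) ` orbit_functor E K0"
  have "Inf {trdeg const_field K0 | K0. ?admissible K0} = enat (n - l)"
  proof (rule antisym)
    have "l \<le> n" "l \<le> m" using l ds by auto
    from orbit_meets_small_field[OF E P(1) P'(1,3) Q(1) this EQ]
    obtain K0 :: "'k ratfun set" where K0: "is_subfield K0" "const_field \<subseteq> K0" "K0 \<subseteq> ratfun_field n"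
      "trdeg const_field K0 \<le> enat (n - l)"
      "\<exists>t\<in>torus m (ratfun_field n). torus_act E t (vec n ratfun_var) \<in> coord_space n K0"
      by metis
    from K0(5) have "?admissible K0"
      using K0(1-3) generic_point_in_image_iff[OF E K0(1,3)] by simp
    hence "trdeg const_field K0 \<in> {trdeg const_field K0 | K0. ?admissible K0}"
      by (intro CollectI exI[of _ K0] conjI refl) simp_all
    hence "Inf {trdeg const_field K0 | K0. ?admissible K0} \<le> trdeg const_field K0"
      by (rule Inf_lower)
    thus "Inf {trdeg const_field K0 | K0. ?admissible K0} \<le> enat (n - l)"
      using K0(4) by (rule order_trans)
  next
    show "enat (n - l) \<le> Inf {trdeg const_field K0 | K0. ?admissible K0}"
    proof (rule Inf_greatest)
      fix e assume "e \<in> {trdeg const_field K0 | K0. ?admissible K0}"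
      then obtain K0 :: "'k ratfun set" where e: "e = trdeg const_field K0"
        and K0: "is_subfield K0" "K0 \<subseteq> ratfun_field n"
        and gp: "generic_point E \<in> orbit_map E K0 (ratfun_field n) ` orbit_functor E K0"
        by (elim CollectE exE conjE) (rule that)
      obtain t where t: "t \<in> torus m (ratfun_field n)"
        "torus_act E t (vec n ratfun_var) \<in> coord_space n K0"
        using gp unfolding generic_point_in_image_iff[OF E K0] by (elim bexE) (rule that)
      show "enat (n - l) \<le> e"
        unfolding e by (rule trdeg_ge_if_orbit_meets[OF E P(1) P'(1,2) d2 _ K0(1) t]) (rule PE)
    qed
  qed
  thus ?thesis unfolding essential_dim_def l_def .
qed

end
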